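(* Assume the Riemann Hypothesis. If $C>2$, then there is a sequence $T_j\to\infty$ with $T_{j+1}-T_j\ll 1$ such that \[ \frac{\xi''}{\xi'}(\sigma+iT_j)\ll (\log T_j)^{C+1} \] uniformly for $-1\leq \sigma\leq 2$ (the implied constants being independent of $j$ and $\sigma$).
   Context: $\xi(s)=\frac12 s(s-1)\pi^{-s/2}\Gamma(\frac s2)\zeta(s)$ is the Riemann xi function, where $\zeta$ is the Riemann zeta function. *)

theory Defs
  imports "HOL-Complex_Analysis.Complex_Analysis"
begin

text \<open>
  The analytic continuation of \<open>\<Sum>n\<ge>1. n\<^bsup>-s\<^esup>\<close> to the plane punctured at \<open>1\<close>. It is unique by the
  identity theorem once a value at the pole is fixed; the value \<open>0\<close> there is a dummy, as for the
  poles of \<open>Gamma\<close>.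
\<close>

definition zeta :: "complex \<Rightarrow> complex" where
  "zeta = (THE f. f holomorphic_on - {1} \<and>
                  (\<forall>s. Re s > 1 \<longrightarrow> f s = (\<Sum>n. of_nat (Suc n) powr (- s))) \<and>
                  f 1 = 0)"

text \<open>
  The product formula breaks down (only) at \<open>1\<close> and at the poles \<open>0, -2, -4, \<dots>\<close> of
  \<open>Gamma (s / 2)\<close>, where HOL's totalised functions make the product \<open>0\<close>. These singularities are
  removable; \<open>remove_sings\<close> fills in the limits there, giving the entire function.
\<close>

definition xi :: "complex \<Rightarrow> complex" where
  "xi = remove_sings
     (\<lambda>s. 1/2 * s * (s - 1) * of_real pi powr (- s / 2) * Gamma (s / 2) * zeta s)"

definition Riemann_Hypothesis :: bool where
  "Riemann_Hypothesis \<longleftrightarrow>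
     (\<forall>s. zeta s = 0 \<and> 0 < Re s \<and> Re s < 1 \<longrightarrow> Re s = 1/2)"

end

theory Submission
  imports Defs
begin

text \<open>
  Let \<open>s\<^sub>0 = 3 + i\<tau>\<close>. Expanding \<open>(n + 1)\<^bsup>1-s\<^esup>\<close> around \<open>n\<close> and summing over \<open>n\<close> expresses
  \<open>(s - 1) \<zeta>(s)\<close> through its translates \<open>s + 1, s + 2, \<dots>\<close>; iterating this continues \<open>(s - 1) \<zeta>(s)\<close> to
  the plane with polynomial growth in every right half-plane. Together with
  \<open>\<psi>(z) = log z + O(1)\<close> it gives \<open>\<bar>\<xi>(s)\<bar> \<le> \<tau>\<^bsup>A\<^esup> \<bar>\<xi>(s\<^sub>0)\<bar>\<close> on a large disc around \<open>s\<^sub>0\<close>, and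
  \<open>\<bar>\<xi>'/\<xi>(s\<^sub>0)\<bar> \<ge> 1\<close> because the digamma term grows like \<open>log \<tau>\<close>. Hence \<open>\<bar>\<xi>'(s)\<bar> \<le> \<tau>\<^bsup>A\<^esup> \<bar>\<xi>'(s\<^sub>0)\<bar>\<close> on
  such a disc, so by Landau's lemma \<open>\<xi>'\<close> has \<open>O(log \<tau>)\<close> zeros \<open>\<rho>\<close> near \<open>s\<^sub>0\<close> and
  \<open>\<xi>''/\<xi>'(s) = \<Sum> 1/(s - \<rho>) + O(log \<tau>)\<close>. By the pigeonhole principle some \<open>T \<in> [\<tau>, \<tau> + 1]\<close> stays at
  distance \<open>\<gg> 1/log \<tau>\<close> from all ordinates \<open>Im \<rho>\<close>, which gives the bound \<open>O((log T)\<^sup>2)\<close>.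
\<close>

section \<open>Analytic continuation of the zeta function\<close>

lemma summable_inverse_Suc_sq: "summable (\<lambda>n. 1 / (real (Suc n))\<^sup>2)"
  using inverse_squares_sums[THEN sums_summable] by (simp only: of_nat_Suc of_nat_add of_nat_1 of_nat_power add.commute[of 1])

text \<open>By the Basel sum \<open>pi\<^sup>2 / 6\<close>. The round bound 2 feeds the remainder
  estimates, the bounds for the Dirichlet series and the digamma estimate.\<close>

lemma suminf_inverse_Suc_sq: "(\<Sum>n. 1 / (real (Suc n))\<^sup>2) \<le> 2"
proof -
  have "(\<Sum>n. 1 / (real (Suc n))\<^sup>2) = pi\<^sup>2 / 6"
    using inverse_squares_sums[THEN sums_unique] by (simp only: of_nat_Suc of_nat_add of_nat_1 of_nat_power add.commute[of 1])
  moreover have "pi\<^sup>2 \<le> 3.2\<^sup>2" using pi_approx by (intro power_mono) auto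
  ultimately show ?thesis by (simp add: power2_eq_square)
qed

lemma norm_Suc_powr: "norm (of_nat (Suc n) powr s :: complex) = real (Suc n) powr Re s"
  by (subst norm_powr_real_powr) auto

definition dirichlet_zeta :: "complex \<Rightarrow> complex" where
  "dirichlet_zeta s = (\<Sum>n. of_nat (Suc n) powr (- s))"

lemma summable_dirichlet_norm:
  assumes "Re s > 1"
  shows "summable (\<lambda>n. norm (of_nat (Suc n) powr (- s) :: complex))"
proof -
  have "summable (\<lambda>n. real n powr (- Re s))"
    using assms by (subst summable_real_powr_iff) auto
  then have "summable (\<lambda>n. real (Suc n) powr (- Re s))"
    by (subst summable_Suc_iff)
  then show ?thesis by (simp add: norm_Suc_powr del: of_nat_Suc)
qed

lemma sums_dirichlet_zeta:
  assumes "Re s > 1"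
  shows "(\<lambda>n. of_nat (Suc n) powr (- s)) sums dirichlet_zeta s"
  unfolding dirichlet_zeta_def using summable_dirichlet_norm[OF assms]
  by (intro summable_sums) (rule summable_norm_cancel)

section \<open>Taylor remainders of complex powers at consecutive integers\<close>

text \<open>The falling factorial: \<open>ffact a j / fact j\<close> is the generalised binomial
  coefficient, and \<open>ffact a j\<close> is the factor in the j-th derivative of
  \<open>x powr a\<close>.\<close>

definition ffact :: "complex \<Rightarrow> nat \<Rightarrow> complex" where
  "ffact a j = (\<Prod>l<j. a - of_nat l)"

text \<open>The remainder when \<open>x powr a\<close> is expanded about the integer n + 1,
  evaluated one unit further on, and cut off after m terms. The index is shifted so that n = 0
  belongs to the integer 1.\<close>

definition pow_rem :: "nat \<Rightarrow> complex \<Rightarrow> nat \<Rightarrow> complex" where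
  "pow_rem m a n = of_nat (Suc (Suc n)) powr a
     - (\<Sum>j<m. ffact a j / fact j * of_nat (Suc n) powr (a - of_nat j))"

lemma ffact_0 [simp]: "ffact a 0 = 1" and ffact_Suc: "ffact a (Suc j) = ffact a j * (a - of_nat j)"
  by (simp_all add: ffact_def)

lemma norm_ffact_le: "norm (ffact a j) \<le> (norm a + real j) ^ j"
proof -
  have "norm (ffact a j) = (\<Prod>l<j. norm (a - of_nat l))" by (simp add: ffact_def prod_norm)
  also have "\<dots> \<le> (\<Prod>l<j. norm a + real j)"
  proof (intro prod_mono conjI)
    fix l assume "l \<in> {..<j}"
    then have "norm (of_nat l :: complex) \<le> real j" by simp
    then show "norm (a - of_nat l) \<le> norm a + real j"
      using norm_triangle_ineq4[of a "of_nat l"] by linarith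
  qed auto
  finally show ?thesis by simp
qed

text \<open>Taylor's theorem on the segment from n + 1 to n + 2. Under the hypothesis the derivative
  of order m + 1 has a modulus that decreases along the segment, so its value at the left end is the
  maximum.\<close>

lemma norm_pow_rem_le:
  assumes a: "Re a \<le> real m"
  shows "norm (pow_rem (Suc m) a n) \<le> norm (ffact a (Suc m)) * real (Suc n) powr (Re a - real (Suc m))"
proof -
  let ?w = "of_nat (Suc n) :: complex" and ?z = "of_nat (Suc (Suc n)) :: complex"
  \<comment> \<open>The i-th derivative of \<open>x powr a\<close>, so that \<open>f 0\<close> is
    the function expanded.\<close>
  define f where "f = (\<lambda>i x. ffact a i * x powr (a - of_nat i))"
  have seg: "\<exists>t\<ge>real (Suc n). x = of_real t" if "x \<in> closed_segment ?w ?z" for x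
  proof -
    from that obtain u where u: "0 \<le> u" "u \<le> 1" "x = (1 - u) *\<^sub>R ?w + u *\<^sub>R ?z"
      by (auto simp: closed_segment_def)
    have "x = of_real (real (Suc n) + u)" using u(3) by (simp add: scaleR_conv_of_real algebra_simps)
    with u show ?thesis by (intro exI[of _ "real (Suc n) + u"]) auto
  qed
  have "norm (f 0 ?z - (\<Sum>i\<le>m. f i ?w * (?z - ?w) ^ i / fact i))
        \<le> norm (ffact a (Suc m)) * real (Suc n) powr (Re a - real (Suc m)) * norm (?z - ?w) ^ Suc m / fact m"
  proof (rule complex_Taylor[where S = "closed_segment ?w ?z"])
    fix i x assume "x \<in> closed_segment ?w ?z"
    then obtain t where t: "t \<ge> real (Suc n)" "x = of_real t" using seg by blast
    then have "x \<notin> \<real>\<^sub>\<le>\<^sub>0" by auto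
    then show "(f i has_field_derivative f (Suc i) x) (at x within closed_segment ?w ?z)"
      unfolding f_def ffact_Suc
      by (auto intro!: derivative_eq_intros simp: algebra_simps)
  next
    fix x assume "x \<in> closed_segment ?w ?z"
    then obtain t where t: "t \<ge> real (Suc n)" "x = of_real t" using seg by blast
    have "norm (f (Suc m) x) = norm (ffact a (Suc m)) * t powr (Re a - real (Suc m))"
      using t by (simp add: f_def norm_mult norm_powr_real_powr)
    also have "\<dots> \<le> norm (ffact a (Suc m)) * real (Suc n) powr (Re a - real (Suc m))"
      using t a by (intro mult_left_mono powr_mono2') auto
    finally show "norm (f (Suc m) x) \<le> norm (ffact a (Suc m)) * real (Suc n) powr (Re a - real (Suc m))" .
  qed auto
  also have "\<dots> \<le> norm (ffact a (Suc m)) * real (Suc n) powr (Re a - real (Suc m))"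
  proof -
    let ?X = "norm (ffact a (Suc m)) * real (Suc n) powr (Re a - real (Suc m))"
    have "?X / fact m \<le> ?X / 1"
      by (rule divide_left_mono) auto
    then show ?thesis by simp
  qed
  also have "f 0 ?z - (\<Sum>i\<le>m. f i ?w * (?z - ?w) ^ i / fact i) = pow_rem (Suc m) a n"
    by (simp add: pow_rem_def f_def lessThan_Suc_atMost mult_ac)
  finally show ?thesis .
qed

text \<open>One unit less in the real part of a pushes the exponent in the remainder bound to -2 or
  below, which makes the remainders summable over n.\<close>

lemma norm_pow_rem_le_inverse_sq:
  assumes m: "Re a \<le> real m - 1"
  shows "norm (pow_rem (Suc m) a n) \<le> (norm a + real (Suc m)) ^ Suc m * (1 / (real (Suc n))\<^sup>2)"
proof -
  have "norm (pow_rem (Suc m) a n) \<le> norm (ffact a (Suc m)) * real (Suc n) powr (Re a - real (Suc m))"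
    by (rule norm_pow_rem_le) (use m in auto)
  also have "\<dots> \<le> (norm a + real (Suc m)) ^ Suc m * real (Suc n) powr (-2)"
    by (intro mult_mono norm_ffact_le powr_mono) (use m in auto)
  also have "real (Suc n) powr (-2) = 1 / (real (Suc n))\<^sup>2"
    by (simp add: powr_minus powr_numeral divide_inverse)
  finally show ?thesis .
qed

lemma pow_rem_sums:
  assumes "Re a \<le> real m - 1"
  shows "summable (pow_rem (Suc m) a)"
    and "norm (\<Sum>n. pow_rem (Suc m) a n) \<le> (norm a + real (Suc m)) ^ Suc m * 2"
proof -
  have S: "summable (\<lambda>n. (norm a + real (Suc m)) ^ Suc m * (1 / (real (Suc n))\<^sup>2))"
    by (intro summable_mult summable_inverse_Suc_sq)
  have *: "summable (\<lambda>n. norm (pow_rem (Suc m) a n))"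
    by (rule summable_comparison_test'[OF S, of 0]) (use norm_pow_rem_le_inverse_sq[OF assms] in simp)
  then show "summable (pow_rem (Suc m) a)" by (rule summable_norm_cancel)
  have "norm (\<Sum>n. pow_rem (Suc m) a n) \<le> (\<Sum>n. norm (pow_rem (Suc m) a n))"
    by (rule summable_norm[OF *])
  also have "\<dots> \<le> (\<Sum>n. (norm a + real (Suc m)) ^ Suc m * (1 / (real (Suc n))\<^sup>2))"
    by (rule suminf_le[OF _ * S]) (rule norm_pow_rem_le_inverse_sq[OF assms])
  also have "\<dots> = (norm a + real (Suc m)) ^ Suc m * (\<Sum>n. 1 / (real (Suc n))\<^sup>2)"
    by (rule suminf_mult[OF summable_inverse_Suc_sq])
  also have "\<dots> \<le> (norm a + real (Suc m)) ^ Suc m * 2"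
    by (intro mult_left_mono suminf_inverse_Suc_sq) simp
  finally show "norm (\<Sum>n. pow_rem (Suc m) a n) \<le> (norm a + real (Suc m)) ^ Suc m * 2" .
qed

text \<open>A local summable majorant gives locally uniform convergence by the Weierstrass test, and
  locally uniform limits of holomorphic functions are holomorphic.\<close>

lemma holomorphic_suminf:
  fixes f :: "nat \<Rightarrow> complex \<Rightarrow> complex"
  assumes S: "open S" and hol: "\<And>n. f n holomorphic_on S"
    and bd: "\<And>x. x \<in> S \<Longrightarrow> \<exists>d>0. \<exists>M. summable M \<and> (\<forall>y\<in>ball x d \<inter> S. \<forall>n. norm (f n y) \<le> M n)"
  shows "(\<lambda>z. \<Sum>n. f n z) holomorphic_on S"
proof (rule holomorphic_uniform_sequence[OF S])
  show "(\<lambda>z. \<Sum>n<k. f n z) holomorphic_on S" for k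
    by (intro holomorphic_intros hol)
  fix x assume x: "x \<in> S"
  obtain d M where d: "d > 0" "summable M" "\<And>y n. y \<in> ball x d \<inter> S \<Longrightarrow> norm (f n y) \<le> M n"
    using bd[OF x] by blast
  obtain e where e: "e > 0" "ball x e \<subseteq> S" using S x openE by blast
  \<comment> \<open>Halving puts the closed disc inside both open balls.\<close>
  let ?d = "min d e / 2"
  have sub: "cball x ?d \<subseteq> ball x d \<inter> S" using d e by (auto simp: subset_iff)
  have "uniform_limit (cball x ?d) (\<lambda>k z. \<Sum>n<k. f n z) (\<lambda>z. \<Sum>n. f n z) sequentially"
    by (rule Weierstrass_m_test[where M = M]) (use d sub in auto)
  then show "\<exists>d>0. cball x d \<subseteq> S \<and> uniform_limit (cball x d) (\<lambda>k z. \<Sum>n<k. f n z) (\<lambda>z. \<Sum>n. f n z) sequentially"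
    using d e sub by (intro exI[of _ ?d]) auto
qed

lemma holomorphic_ffact [holomorphic_intros]:
  "f holomorphic_on S \<Longrightarrow> (\<lambda>s. ffact (f s) j) holomorphic_on S"
  unfolding ffact_def by (intro holomorphic_intros)

text \<open>With a = 1 - s the half-plane is where the inverse-square bound for k + 2 Taylor terms
  applies. On the unit ball around x the majorant is made uniform through
  \<open>norm (1 - y) \<le> norm x + 2\<close>.\<close>

lemma holomorphic_pow_rem_suminf:
  "(\<lambda>s. \<Sum>n. pow_rem (Suc (Suc k)) (1 - s) n) holomorphic_on {s. Re s > 1 - real k}"
proof (rule holomorphic_suminf)
  show "open {s. Re s > 1 - real k}" by (rule open_halfspace_Re_gt)
  show "(\<lambda>s. pow_rem (Suc (Suc k)) (1 - s) n) holomorphic_on {s. Re s > 1 - real k}" for n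
    unfolding pow_rem_def by (intro holomorphic_intros) auto
  fix x :: complex assume x: "x \<in> {s. Re s > 1 - real k}"
  have "norm (pow_rem (Suc (Suc k)) (1 - y) n) \<le> (norm x + 2 + real (Suc (Suc k))) ^ Suc (Suc k) * (1 / (real (Suc n))\<^sup>2)"
    if y: "y \<in> ball x 1 \<inter> {s. Re s > 1 - real k}" for y n
  proof -
    have "norm (1 - y) \<le> 1 + norm y" using norm_triangle_ineq4[of 1 y] by simp
    moreover have "norm y \<le> norm x + 1"
      using y norm_triangle_ineq2[of y x] by (simp add: dist_norm norm_minus_commute)
    ultimately have "norm (1 - y) \<le> norm x + 2" by simp
    then have "(norm (1 - y) + real (Suc (Suc k))) ^ Suc (Suc k) \<le> (norm x + 2 + real (Suc (Suc k))) ^ Suc (Suc k)"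
      by (intro power_mono) auto
    moreover have "norm (pow_rem (Suc (Suc k)) (1 - y) n)
        \<le> (norm (1 - y) + real (Suc (Suc k))) ^ Suc (Suc k) * (1 / (real (Suc n))\<^sup>2)"
      by (rule norm_pow_rem_le_inverse_sq) (use y in auto)
    ultimately show ?thesis
      by (meson mult_right_mono order_trans zero_le_divide_1_iff zero_le_power2)
  qed
  moreover have "summable (\<lambda>n. (norm x + 2 + real (Suc (Suc k))) ^ Suc (Suc k) * (1 / (real (Suc n))\<^sup>2))"
    by (intro summable_mult summable_inverse_Suc_sq)
  ultimately show "\<exists>d>0. \<exists>M. summable M \<and> (\<forall>y\<in>ball x d \<inter> {s. Re s > 1 - real k}. \<forall>n. norm (pow_rem (Suc (Suc k)) (1 - y) n) \<le> M n)"
    by (intro exI[of _ 1] conjI exI[of _ "\<lambda>n. (norm x + 2 + real (Suc (Suc k))) ^ Suc (Suc k) * (1 / (real (Suc n))\<^sup>2)"] ballI allI zero_less_one)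
qed

section \<open>The recursion linking (s - 1) zeta(s) to its right translates\<close>

lemma telescope_powr:
  assumes "Re s > 1"
  shows "(\<lambda>n. of_nat (Suc (Suc n)) powr (1 - s) - of_nat (Suc n) powr (1 - s) :: complex) sums (0 - 1)"
proof -
  have "(\<lambda>n. real n powr (- (Re s - 1))) \<longlonglongrightarrow> 0"
    by (rule tendsto_neg_powr) (use assms filterlim_real_sequentially in auto)
  then have "(\<lambda>n. real (Suc n) powr (- (Re s - 1))) \<longlonglongrightarrow> 0"
    by (rule LIMSEQ_Suc)
  then have "(\<lambda>n. norm (of_nat (Suc n) powr (1 - s) :: complex)) \<longlonglongrightarrow> 0"
    by (simp only: norm_Suc_powr) (simp add: algebra_simps)
  then have "(\<lambda>n. of_nat (Suc n) powr (1 - s) :: complex) \<longlonglongrightarrow> 0"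
    by (rule tendsto_norm_zero_cancel)
  from telescope_sums[OF this] show ?thesis by simp
qed

text \<open>Expand each difference in \<open>telescope_powr\<close> by Taylor and sum over n. The
  linear term yields (1 - s) zeta(s) and the higher terms yield the translates. Each coefficient
  \<open>ffact (1 - s) (Suc i)\<close> contains the factor s + i - 1 up to sign, so only the
  pole-free products (s + i - 1) zeta(s + i) occur.\<close>

lemma dirichlet_zeta_recursion:
  assumes s: "Re s > 1"
  shows "(s - 1) * dirichlet_zeta s =
     1 - (\<Sum>i=1..k. ffact (1 - s) i / fact (Suc i) * ((s + of_nat i - 1) * dirichlet_zeta (s + of_nat i)))
       + (\<Sum>n. pow_rem (Suc (Suc k)) (1 - s) n)"
proof -
  let ?F = "\<lambda>i. ffact (1 - s) i / fact (Suc i) * ((s + of_nat i - 1) * dirichlet_zeta (s + of_nat i))"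
  have summand: "(\<lambda>n. ffact (1 - s) (Suc i) / fact (Suc i) * of_nat (Suc n) powr ((1 - s) - of_nat (Suc i)))
         sums (- ?F i)" for i
  proof -
    have "(\<lambda>n. ffact (1 - s) (Suc i) / fact (Suc i) * of_nat (Suc n) powr (- (s + of_nat i)))
        sums (ffact (1 - s) (Suc i) / fact (Suc i) * dirichlet_zeta (s + of_nat i))"
      by (intro sums_mult sums_dirichlet_zeta) (use s in simp)
    also have "ffact (1 - s) (Suc i) / fact (Suc i) * dirichlet_zeta (s + of_nat i) = - ?F i"
    proof -
      have "ffact (1 - s) (Suc i) = - (ffact (1 - s) i * (s + of_nat i - 1))"
        by (simp add: ffact_Suc algebra_simps)
      then show ?thesis by (simp only: minus_divide_left[symmetric] mult_minus_left times_divide_eq_left mult.assoc)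
    qed
    also have "- (s + of_nat i) = (1 - s) - of_nat (Suc i)" by simp
    finally show ?thesis .
  qed
  \<comment> \<open>The Taylor terms of order 1 to k + 1 are subtracted here; the term of order 0 is
    already part of the telescoping difference.\<close>
  have "(\<lambda>n. (of_nat (Suc (Suc n)) powr (1 - s) - of_nat (Suc n) powr (1 - s))
       - (\<Sum>i<Suc k. ffact (1 - s) (Suc i) / fact (Suc i) * of_nat (Suc n) powr ((1 - s) - of_nat (Suc i))))
       sums ((0 - 1) - (\<Sum>i<Suc k. - ?F i))"
    by (intro sums_diff telescope_powr s sums_sum summand)
  moreover have "(of_nat (Suc (Suc n)) powr (1 - s) - of_nat (Suc n) powr (1 - s))
       - (\<Sum>i<Suc k. ffact (1 - s) (Suc i) / fact (Suc i) * of_nat (Suc n) powr ((1 - s) - of_nat (Suc i)))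
       = pow_rem (Suc (Suc k)) (1 - s) n" for n
    unfolding pow_rem_def sum.lessThan_Suc_shift[of _ "Suc k"] by simp
  ultimately have "(\<Sum>n. pow_rem (Suc (Suc k)) (1 - s) n) = (0 - 1) - (\<Sum>i<Suc k. - ?F i)"
    by (simp add: sums_iff)
  also have "(\<Sum>i<Suc k. - ?F i) = - ?F 0 - (\<Sum>i=1..k. ?F i)"
    unfolding sum.lessThan_Suc_shift by (simp add: sum_negf sum.atLeast1_atMost_eq)
  finally show ?thesis by (simp add: algebra_simps)
qed

text \<open>The recursion read as a definition: stage k represents (s - 1) zeta(s) for
  \<open>Re s > 1 - real k\<close>, and each stage gains one unit to the left. Outside that
  half-plane its values carry no meaning, since nothing guarantees that the series
  converges.\<close>

primrec zeta_aux :: "nat \<Rightarrow> complex \<Rightarrow> complex" where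
  "zeta_aux 0 s = 1 + (\<Sum>n. pow_rem (Suc (Suc 0)) (1 - s) n)"
| "zeta_aux (Suc k) s = 1
     - (\<Sum>i=1..Suc k. ffact (1 - s) i / fact (Suc i) * zeta_aux k (s + of_nat i))
     + (\<Sum>n. pow_rem (Suc (Suc (Suc k))) (1 - s) n)"

lemma zeta_aux_eq: "Re s > 1 \<Longrightarrow> zeta_aux k s = (s - 1) * dirichlet_zeta s"
proof (induction k arbitrary: s)
  case 0
  then show ?case using dirichlet_zeta_recursion[of s 0] by simp
next
  case (Suc k)
  have "zeta_aux k (s + of_nat i) = (s + of_nat i - 1) * dirichlet_zeta (s + of_nat i)" for i
    by (rule Suc.IH) (use Suc.prems in simp)
  then show ?case
    by (simp only: zeta_aux.simps dirichlet_zeta_recursion[OF Suc.prems, of "Suc k"])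
qed

text \<open>The translates s + i have i at least 1, so they land in the half-plane of the previous
  stage.\<close>

lemma zeta_aux_holomorphic: "zeta_aux k holomorphic_on {s. Re s > 1 - real k}"
proof (induction k)
  case 0
  show ?case using holomorphic_pow_rem_suminf[of 0] by (auto intro!: holomorphic_intros)
next
  case (Suc k)
  have "(\<lambda>s. zeta_aux k (s + of_nat i)) holomorphic_on {s. Re s > 1 - real (Suc k)}" if "i \<in> {1..Suc k}" for i
    by (rule holomorphic_on_compose_gen[OF _ Suc.IH, unfolded o_def])
      (use that in \<open>auto intro!: holomorphic_intros\<close>)
  then show ?case
    unfolding zeta_aux.simps using holomorphic_pow_rem_suminf[of "Suc k"]
    by (intro holomorphic_intros) auto
qed

text \<open>The bound of \<open>pow_rem_sums\<close> in purely polynomial form, from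
  \<open>norm (1 - s) + (k + 2) \<le> (k + 3) * (1 + norm s)\<close>.\<close>

lemma norm_pow_rem_suminf_le:
  assumes "Re s > 1 - real k"
  shows "norm (\<Sum>n. pow_rem (Suc (Suc k)) (1 - s) n) \<le> 2 * (real k + 3) ^ Suc (Suc k) * (1 + norm s) ^ Suc (Suc k)"
proof -
  have "norm (1 - s) \<le> 1 + norm s" using norm_triangle_ineq4[of 1 s] by simp
  moreover have "real (Suc (Suc k)) \<le> (1 + norm s) * (real k + 2)"
  proof -
    have "real (Suc (Suc k)) = 1 * (real k + 2)" by simp
    also have "\<dots> \<le> (1 + norm s) * (real k + 2)" by (intro mult_right_mono) auto
    finally show ?thesis .
  qed
  ultimately have "norm (1 - s) + real (Suc (Suc k)) \<le> (1 + norm s) + (1 + norm s) * (real k + 2)"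
    by (rule add_mono)
  also have "\<dots> = (real k + 3) * (1 + norm s)" by (simp add: algebra_simps)
  finally have "(norm (1 - s) + real (Suc (Suc k))) ^ Suc (Suc k) \<le> ((real k + 3) * (1 + norm s)) ^ Suc (Suc k)"
    by (intro power_mono) auto
  moreover have "norm (\<Sum>n. pow_rem (Suc (Suc k)) (1 - s) n) \<le> (norm (1 - s) + real (Suc (Suc k))) ^ Suc (Suc k) * 2"
    by (rule pow_rem_sums(2)) (use assms in auto)
  ultimately show ?thesis unfolding power_mult_distrib by linarith
qed

section \<open>Polynomial growth of the continuation\<close>

text \<open>Constant and exponent are existentially quantified so that the property is closed under
  sums, products and translates; the growth of each stage then follows without tracking
  exponents.\<close>

definition poly_bounded_on :: "complex set \<Rightarrow> (complex \<Rightarrow> complex) \<Rightarrow> bool" where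
  "poly_bounded_on S f \<longleftrightarrow> (\<exists>A B. \<forall>s\<in>S. norm (f s) \<le> A * (1 + norm s) ^ B)"

lemma poly_bounded_onI: "(\<And>s. s \<in> S \<Longrightarrow> norm (f s) \<le> A * (1 + norm s) ^ B) \<Longrightarrow> poly_bounded_on S f"
  unfolding poly_bounded_on_def by blast

lemma poly_bounded_onE:
  assumes "poly_bounded_on S f"
  obtains A B where "A \<ge> 0" "\<And>s. s \<in> S \<Longrightarrow> norm (f s) \<le> A * (1 + norm s) ^ B"
proof -
  obtain A B where AB: "\<And>s. s \<in> S \<Longrightarrow> norm (f s) \<le> A * (1 + norm s) ^ B"
    using assms unfolding poly_bounded_on_def by blast
  have "norm (f s) \<le> \<bar>A\<bar> * (1 + norm s) ^ B" if "s \<in> S" for s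
    by (rule order_trans[OF AB[OF that]]) (intro mult_right_mono, auto)
  then show ?thesis using that[of "\<bar>A\<bar>" B] by simp
qed

lemma poly_bounded_on_const: "poly_bounded_on S (\<lambda>_. c)"
  by (rule poly_bounded_onI[where A = "norm c" and B = 0]) simp

lemma poly_bounded_on_add:
  assumes "poly_bounded_on S f" "poly_bounded_on S g"
  shows "poly_bounded_on S (\<lambda>s. f s + g s)"
proof -
  obtain A B where f: "A \<ge> 0" "\<And>s. s \<in> S \<Longrightarrow> norm (f s) \<le> A * (1 + norm s) ^ B"
    using assms(1) by (rule poly_bounded_onE) blast
  obtain A' B' where g: "A' \<ge> 0" "\<And>s. s \<in> S \<Longrightarrow> norm (g s) \<le> A' * (1 + norm s) ^ B'"
    using assms(2) by (rule poly_bounded_onE) blast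
  show ?thesis
  proof (rule poly_bounded_onI)
    fix s assume s: "s \<in> S"
    have "norm (f s + g s) \<le> A * (1 + norm s) ^ B + A' * (1 + norm s) ^ B'"
      using f(2)[OF s] g(2)[OF s] norm_triangle_ineq[of "f s" "g s"] by linarith
    also have "\<dots> \<le> A * (1 + norm s) ^ max B B' + A' * (1 + norm s) ^ max B B'"
      using f(1) g(1) by (intro add_mono mult_left_mono power_increasing) auto
    finally show "norm (f s + g s) \<le> (A + A') * (1 + norm s) ^ max B B'" by (simp add: algebra_simps)
  qed
qed

lemma poly_bounded_on_mult:
  assumes "poly_bounded_on S f" "poly_bounded_on S g"
  shows "poly_bounded_on S (\<lambda>s. f s * g s)"
proof -
  obtain A B where f: "A \<ge> 0" "\<And>s. s \<in> S \<Longrightarrow> norm (f s) \<le> A * (1 + norm s) ^ B"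
    using assms(1) by (rule poly_bounded_onE) blast
  obtain A' B' where g: "A' \<ge> 0" "\<And>s. s \<in> S \<Longrightarrow> norm (g s) \<le> A' * (1 + norm s) ^ B'"
    using assms(2) by (rule poly_bounded_onE) blast
  show ?thesis
  proof (rule poly_bounded_onI)
    fix s assume s: "s \<in> S"
    have "norm (f s * g s) \<le> (A * (1 + norm s) ^ B) * (A' * (1 + norm s) ^ B')"
      unfolding norm_mult using f(1) by (intro mult_mono f g s) auto
    then show "norm (f s * g s) \<le> (A * A') * (1 + norm s) ^ (B + B')" by (simp add: power_add mult_ac)
  qed
qed

lemma poly_bounded_on_sum:
  "(\<And>i. i \<in> I \<Longrightarrow> poly_bounded_on S (f i)) \<Longrightarrow> poly_bounded_on S (\<lambda>s. \<Sum>i\<in>I. f i s)"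
  by (induction I rule: infinite_finite_induct) (simp_all add: poly_bounded_on_const poly_bounded_on_add)

lemma poly_bounded_on_ident: "poly_bounded_on S (\<lambda>s. s)"
  by (rule poly_bounded_onI[where A = 1 and B = 1]) simp

lemma poly_bounded_on_uminus: "poly_bounded_on S f \<Longrightarrow> poly_bounded_on S (\<lambda>s. - f s)"
  using poly_bounded_on_mult[OF poly_bounded_on_const[of S "-1"], of f] by simp

lemma poly_bounded_on_diff:
  "poly_bounded_on S f \<Longrightarrow> poly_bounded_on S g \<Longrightarrow> poly_bounded_on S (\<lambda>s. f s - g s)"
  using poly_bounded_on_add[OF _ poly_bounded_on_uminus, of S f g] by simp

text \<open>Rests on \<open>1 + norm (s + c) \<le> (1 + norm c) * (1 + norm s)\<close>.\<close>

lemma poly_bounded_on_compose_add: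
  assumes "poly_bounded_on S' f" "\<And>s. s \<in> S \<Longrightarrow> s + c \<in> S'"
  shows "poly_bounded_on S (\<lambda>s. f (s + c))"
proof -
  obtain A B where f: "A \<ge> 0" "\<And>s. s \<in> S' \<Longrightarrow> norm (f s) \<le> A * (1 + norm s) ^ B"
    using assms(1) by (rule poly_bounded_onE) blast
  show ?thesis
  proof (rule poly_bounded_onI)
    fix s assume s: "s \<in> S"
    have "1 + norm (s + c) \<le> (1 + norm c) * (1 + norm s)"
      using norm_triangle_ineq[of s c] by (simp add: algebra_simps) (smt (verit) mult_nonneg_nonneg norm_ge_zero)
    then have "A * (1 + norm (s + c)) ^ B \<le> A * ((1 + norm c) * (1 + norm s)) ^ B"
      using f(1) by (intro mult_left_mono power_mono) auto
    then show "norm (f (s + c)) \<le> (A * (1 + norm c) ^ B) * (1 + norm s) ^ B"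
      using f(2)[OF assms(2)[OF s]] by (simp add: power_mult_distrib mult.assoc)
  qed
qed

lemma poly_bounded_on_ffact: "poly_bounded_on S (\<lambda>s. ffact (1 - s) i)"
proof (induction i)
  case 0
  show ?case by (simp add: poly_bounded_on_const)
next
  case (Suc i)
  show ?case unfolding ffact_Suc
    by (intro poly_bounded_on_mult Suc poly_bounded_on_diff poly_bounded_on_const poly_bounded_on_ident)
qed

lemma poly_bounded_on_pow_rem:
  "poly_bounded_on {s. Re s > 1 - real k} (\<lambda>s. \<Sum>n. pow_rem (Suc (Suc k)) (1 - s) n)"
  by (rule poly_bounded_onI, rule norm_pow_rem_suminf_le) simp

lemma zeta_aux_poly_bounded: "poly_bounded_on {s. Re s > 1 - real k} (zeta_aux k)"
proof (induction k)
  case 0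
  show ?case unfolding zeta_aux.simps
    by (intro poly_bounded_on_add poly_bounded_on_const poly_bounded_on_pow_rem)
next
  case (Suc k)
  have "poly_bounded_on {s. Re s > 1 - real (Suc k)} (\<lambda>s. zeta_aux k (s + of_nat i))"
    if "i \<in> {1..Suc k}" for i
    by (rule poly_bounded_on_compose_add[OF Suc.IH]) (use that in auto)
  then show ?case unfolding zeta_aux.simps divide_inverse
    by (intro poly_bounded_on_add poly_bounded_on_diff poly_bounded_on_const poly_bounded_on_pow_rem
        poly_bounded_on_sum poly_bounded_on_mult poly_bounded_on_ffact)
qed

section \<open>Gluing the stages and identifying \<open>zeta\<close>\<close>

text \<open>Both stages equal (s - 1) zeta(s) for Re s > 1, and the smaller of their two half-planes
  is connected, so the identity theorem applies.\<close>

lemma zeta_aux_consistent: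
  assumes "Re s > 1 - real k" "Re s > 1 - real l"
  shows "zeta_aux k s = zeta_aux l s"
proof (rule analytic_continuation_open[of "{s. Re s > 1}" "{s. Re s > 1 - real (min k l)}" "zeta_aux k" "zeta_aux l"])
  show "open {s. Re s > 1}" "open {s. Re s > 1 - real (min k l)}"
    by (rule open_halfspace_Re_gt)+
  show "connected {s. Re s > 1 - real (min k l)}"
    by (intro convex_connected convex_halfspace_Re_gt)
  have "2 \<in> {s. Re s > 1}" by simp
  then show "{s. Re s > 1} \<noteq> {}" by blast
  show "zeta_aux k holomorphic_on {s. Re s > 1 - real (min k l)}"
    "zeta_aux l holomorphic_on {s. Re s > 1 - real (min k l)}"
    by (rule holomorphic_on_subset[OF zeta_aux_holomorphic]; force)+
qed (use assms in \<open>auto simp: zeta_aux_eq min_def\<close>)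

text \<open>The entire function (s - 1) zeta(s). The stage chosen is at least 2 - Re s, hence valid
  at s; for Re s > 2 the truncation by \<open>nat\<close> selects stage 0.\<close>

definition zeta_num :: "complex \<Rightarrow> complex" where
  "zeta_num s = zeta_aux (nat \<lceil>2 - Re s\<rceil>) s"

lemma zeta_num_eq_aux:
  assumes "Re s > 1 - real k"
  shows "zeta_num s = zeta_aux k s"
  unfolding zeta_num_def by (rule zeta_aux_consistent) (use assms in linarith)+

lemma zeta_num_holomorphic: "zeta_num holomorphic_on S"
proof -
  have "zeta_num field_differentiable at s" for s
  proof -
    obtain k :: nat where k: "1 - real k < Re s" using reals_Archimedean2[of "1 - Re s"] by (auto simp: algebra_simps)
    have "zeta_num holomorphic_on {s. Re s > 1 - real k}"
      by (rule holomorphic_transform[OF zeta_aux_holomorphic]) (simp add: zeta_num_eq_aux)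
    then show ?thesis
      by (rule holomorphic_on_imp_differentiable_at) (use k in \<open>auto simp: open_halfspace_Re_gt\<close>)
  qed
  then show ?thesis by (simp add: holomorphic_on_def field_differentiable_at_within)
qed

lemma zeta_num_poly_bounded: "poly_bounded_on {s. Re s > 1 - real k} zeta_num"
  using zeta_aux_poly_bounded[of k] unfolding poly_bounded_on_def by (simp add: zeta_num_eq_aux)

lemma zeta_num_eq: "Re s > 1 \<Longrightarrow> zeta_num s = (s - 1) * dirichlet_zeta s"
  by (subst zeta_num_eq_aux[of 0]) (simp_all add: zeta_aux_eq del: zeta_aux.simps)

text \<open>The quotient satisfies the description defining \<open>zeta\<close>. Uniqueness is the
  identity theorem on the punctured plane, which is connected, with the value at 1 prescribed
  separately.\<close>

lemma zeta_eq:
  assumes "s \<noteq> 1"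
  shows "zeta s = zeta_num s / (s - 1)"
proof -
  let ?P = "\<lambda>f. f holomorphic_on - {1} \<and> (\<forall>s. Re s > 1 \<longrightarrow> f s = (\<Sum>n. of_nat (Suc n) powr (- s))) \<and>
                  f 1 = (0::complex)"
  let ?z = "\<lambda>s. if s = 1 then 0 else zeta_num s / (s - 1)"
  have hol: "?z holomorphic_on - {1}"
  proof (rule holomorphic_transform)
    show "(\<lambda>s. zeta_num s / (s - 1)) holomorphic_on - {1}"
      by (intro holomorphic_intros zeta_num_holomorphic) auto
  qed auto
  have eq: "?z s = (\<Sum>n. of_nat (Suc n) powr (- s))" if "Re s > 1" for s
    using that by (auto simp: zeta_num_eq dirichlet_zeta_def[symmetric] simp del: of_nat_Suc)
  have P: "?P ?z" using hol eq by auto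
  have "zeta = ?z" unfolding zeta_def
  proof (rule the_equality[where P = ?P and a = ?z])
    show "?P ?z" by (rule P)
  next
    fix f assume f: "?P f"
    show "f = ?z"
    proof
      fix s
      show "f s = ?z s"
      proof (cases "s = 1")
        case False
        show ?thesis
        proof (rule analytic_continuation_open[of "{s. Re s > 1}" "- {1}" f ?z])
          show "open {s. Re s > 1}" by (rule open_halfspace_Re_gt)
          have "2 \<in> {s. Re s > 1}" by simp
          then show "{s. Re s > 1} \<noteq> {}" by blast
          show "connected (- {1::complex})"
            by (rule connected_punctured_universe) simp
          show "f z = ?z z" if "z \<in> {s. Re s > 1}" for z
            using f eq[of z] that by (simp del: of_nat_Suc)
        qed (use f hol False in auto)
      qed (use f in simp)
    qed
  qed
  then have "zeta s = ?z s" by (rule fun_cong)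
  then show ?thesis using assms by simp
qed

section \<open>Size of the Dirichlet series far to the right\<close>

lemma norm_dirichlet_zeta_le:
  assumes "Re s \<ge> 2"
  shows "norm (dirichlet_zeta s) \<le> 2"
proof -
  have le: "norm (of_nat (Suc n) powr (- s) :: complex) \<le> 1 / (real (Suc n))\<^sup>2" for n
  proof -
    have "norm (of_nat (Suc n) powr (- s) :: complex) \<le> real (Suc n) powr (-2)"
      unfolding norm_Suc_powr by (intro powr_mono) (use assms in auto)
    then show ?thesis by (simp add: powr_minus divide_inverse)
  qed
  have S: "summable (\<lambda>n. norm (of_nat (Suc n) powr (- s) :: complex))"
    by (rule summable_dirichlet_norm) (use assms in simp)
  have "norm (dirichlet_zeta s) \<le> (\<Sum>n. norm (of_nat (Suc n) powr (- s) :: complex))"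
    unfolding dirichlet_zeta_def by (rule summable_norm[OF S])
  also have "\<dots> \<le> (\<Sum>n. 1 / (real (Suc n))\<^sup>2)"
    by (rule suminf_le[OF le S summable_inverse_Suc_sq])
  finally show ?thesis using suminf_inverse_Suc_sq by linarith
qed

text \<open>The term 1 dominates: for n at least 2 the n-th term is at most half of 1/n^2, and these
  inverse squares sum to at most 1. This is why the discs below are centred on the line Re s =
  3.\<close>

lemma norm_dirichlet_zeta_ge:
  assumes "Re s \<ge> 3"
  shows "norm (dirichlet_zeta s) \<ge> 1 / 2"
proof -
  have le: "norm (of_nat (Suc (Suc n)) powr (- s) :: complex) \<le> 1 / 2 * (1 / (real (Suc (Suc n)))\<^sup>2)" for n
  proof -
    have "norm (of_nat (Suc (Suc n)) powr (- s) :: complex) \<le> real (Suc (Suc n)) powr (-3)"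
      unfolding norm_Suc_powr by (intro powr_mono) (use assms in auto)
    also have "\<dots> = 1 / real (Suc (Suc n)) * (1 / (real (Suc (Suc n)))\<^sup>2)"
      by (simp add: powr_minus power3_eq_cube power2_eq_square field_simps del: of_nat_Suc)
    also have "\<dots> \<le> 1 / 2 * (1 / (real (Suc (Suc n)))\<^sup>2)"
      by (intro mult_right_mono divide_left_mono) auto
    finally show ?thesis .
  qed
  have S: "summable (\<lambda>n. norm (of_nat (Suc n) powr (- s) :: complex))"
    by (rule summable_dirichlet_norm) (use assms in simp)
  note S' = summable_Suc_iff[THEN iffD2, OF S]
  have Q: "summable (\<lambda>n. 1 / (real (Suc (Suc n)))\<^sup>2)"
    using summable_Suc_iff[THEN iffD2, OF summable_inverse_Suc_sq] .
  have "dirichlet_zeta s = (\<Sum>n. of_nat (Suc (Suc n)) powr (- s)) + 1"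
    unfolding dirichlet_zeta_def using suminf_split_head[OF summable_norm_cancel[OF S]] by simp
  moreover have "norm (\<Sum>n. of_nat (Suc (Suc n)) powr (- s) :: complex) \<le> 1 / 2"
  proof -
    have "norm (\<Sum>n. of_nat (Suc (Suc n)) powr (- s) :: complex) \<le> (\<Sum>n. norm (of_nat (Suc (Suc n)) powr (- s) :: complex))"
      by (rule summable_norm[OF S'])
    also have "\<dots> \<le> (\<Sum>n. 1 / 2 * (1 / (real (Suc (Suc n)))\<^sup>2))"
      by (rule suminf_le[OF le S' summable_mult[OF Q]])
    also have "\<dots> = 1 / 2 * (\<Sum>n. 1 / (real (Suc (Suc n)))\<^sup>2)" by (rule suminf_mult[OF Q])
    also have "\<dots> \<le> 1 / 2"
      using suminf_split_head[OF summable_inverse_Suc_sq] suminf_inverse_Suc_sq by simp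
    finally show ?thesis .
  qed
  ultimately show ?thesis
    using norm_triangle_ineq2[of 1 "- (\<Sum>n. of_nat (Suc (Suc n)) powr (- s) :: complex)"] by (simp add: add.commute)
qed

section \<open>Growth of the Gamma function\<close>

lemma norm_Suc_le_add_nat:
  assumes "Re z \<ge> 1"
  shows "real (Suc n) \<le> norm (z + of_nat n)"
  using complex_Re_le_cmod[of "z + of_nat n"] assms by simp

text \<open>First-order Taylor expansion of \<open>Ln\<close> at w with step 1, inside the convex
  half-plane Re x \<ge> r, where the second derivative -1/x^2 is bounded by 1/r^2.\<close>

lemma Ln_step_bound:
  assumes w: "Re w \<ge> r" "r > 0"
  shows "norm (1 / w - (Ln (w + 1) - Ln w)) \<le> 1 / r\<^sup>2"
proof -
  define f where "f = (\<lambda>i (x::complex). if i = (0::nat) then Ln x else if i = 1 then 1 / x else - 1 / x\<^sup>2)"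
  have "norm (f 0 (w + 1) - (\<Sum>i\<le>1. f i w * ((w + 1) - w) ^ i / fact i)) \<le> 1 / r\<^sup>2 * norm ((w + 1) - w) ^ Suc 1 / fact 1"
  proof (rule complex_Taylor[where S = "{x. Re x \<ge> r}"])
    show "convex {x. r \<le> Re x}" by (rule convex_halfspace_Re_ge)
  next
    fix i x assume x: "x \<in> {x. r \<le> Re x}" and "i \<le> (1::nat)"
    then have nz: "x \<noteq> 0" "x \<notin> \<real>\<^sub>\<le>\<^sub>0" using w(2) by (auto simp: complex_nonpos_Reals_iff)
    from \<open>i \<le> 1\<close> consider "i = 0" | "i = 1" by linarith
    then show "(f i has_field_derivative f (Suc i) x) (at x within {x. r \<le> Re x})"
      by cases (use nz in \<open>auto simp: f_def power2_eq_square inverse_eq_divide intro!: derivative_eq_intros\<close>)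
  next
    fix x assume x: "x \<in> {x. r \<le> Re x}"
    then have "r \<le> norm x" using complex_Re_le_cmod[of x] by simp
    then have "r\<^sup>2 \<le> (norm x)\<^sup>2" using w(2) by (intro power_mono) auto
    then have "1 / (norm x)\<^sup>2 \<le> 1 / r\<^sup>2" using w(2) by (intro frac_le) auto
    then show "norm (f (Suc 1) x) \<le> 1 / r\<^sup>2"
      by (simp add: f_def norm_divide norm_power)
  qed (use w in auto)
  then show ?thesis by (simp add: f_def norm_minus_commute algebra_simps)
qed

text \<open>In the limit formula for \<open>Digamma\<close>, the sum of 1/(z + n) is compared
  termwise with the telescoping increments of \<open>Ln (z + n)\<close>. The errors are at most 1/(n
  + 1)^2, and \<open>Ln (z + m)\<close> and \<open>ln m\<close> agree in the limit.\<close>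

lemma Digamma_minus_Ln_bound:
  assumes z: "Re z \<ge> 1"
  shows "norm (Digamma z - Ln z) \<le> 2"
proof -
  have step: "norm (1 / (z + of_nat n) - (Ln (z + of_nat (Suc n)) - Ln (z + of_nat n))) \<le> 1 / (real (Suc n))\<^sup>2" for n
    using Ln_step_bound[of "real (Suc n)" "z + of_nat n"] z by (simp add: add_ac)
  have bd: "norm ((\<Sum>n<m. 1 / (z + of_nat n)) - (Ln (z + of_nat m) - Ln z)) \<le> 2" for m
  proof -
    have "(\<Sum>n<m. 1 / (z + of_nat n)) - (Ln (z + of_nat m) - Ln z)
       = (\<Sum>n<m. 1 / (z + of_nat n) - (Ln (z + of_nat (Suc n)) - Ln (z + of_nat n)))"
      by (simp only: sum_subtractf[of "\<lambda>n. 1 / (z + of_nat n)"] sum_lessThan_telescope[of "\<lambda>n. Ln (z + of_nat n)"]) simp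
    also have "norm \<dots> \<le> (\<Sum>n<m. 1 / (real (Suc n))\<^sup>2)"
      by (rule order_trans[OF norm_sum sum_mono[OF step]])
    also have "\<dots> \<le> (\<Sum>n. 1 / (real (Suc n))\<^sup>2)"
      by (rule sum_le_suminf[OF summable_inverse_Suc_sq]) auto
    also have "\<dots> \<le> 2" by (rule suminf_inverse_Suc_sq)
    finally show ?thesis .
  qed
  have z0: "z \<noteq> 0" using z by auto
  have D: "(\<lambda>m. of_real (ln (real m)) - (\<Sum>n<m. inverse (z + of_nat n))) \<longlonglongrightarrow> Digamma z"
    by (rule Digamma_LIMSEQ[OF z0])
  have L: "(\<lambda>m. Ln (z + of_nat m) - of_real (ln (real m))) \<longlonglongrightarrow> 0"
  proof -
    have "(\<lambda>m. z * inverse (of_nat m) + 1) \<longlonglongrightarrow> z * 0 + 1"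
      by (intro tendsto_intros lim_inverse_n)
    then have "(\<lambda>m. z / of_nat m + 1) \<longlonglongrightarrow> 1" by (simp add: divide_inverse)
    then have "(\<lambda>m. Ln (z / of_nat m + 1)) \<longlonglongrightarrow> Ln 1"
      by (intro tendsto_Ln) auto
    moreover have "\<forall>\<^sub>F m in sequentially. Ln (z / of_nat m + 1) = Ln (z + of_nat m) - of_real (ln (real m))"
    proof (rule eventually_sequentiallyI[of 1])
      fix m :: nat assume m: "1 \<le> m"
      have "Ln (z / of_nat m + 1) = Ln ((z + of_nat m) / of_real (real m))"
        using m by (simp add: field_simps)
      also have "\<dots> = Ln (z + of_nat m) - of_real (ln (real m))"
      proof -
        have "z + of_nat m \<noteq> 0" using z m by (metis norm_Suc_le_add_nat norm_zero of_nat_0_less_iff not_less zero_less_Suc)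
        then show ?thesis using m by (subst Ln_divide_of_real) auto
      qed
      finally show "Ln (z / of_nat m + 1) = Ln (z + of_nat m) - of_real (ln (real m))" .
    qed
    ultimately show ?thesis by (simp add: tendsto_cong)
  qed
  have "(\<lambda>m. (of_real (ln (real m)) - (\<Sum>n<m. inverse (z + of_nat n))) + (Ln (z + of_nat m) - of_real (ln (real m))) - Ln z)
     \<longlonglongrightarrow> Digamma z + 0 - Ln z"
    by (intro tendsto_intros D L)
  then have "(\<lambda>m. norm ((of_real (ln (real m)) - (\<Sum>n<m. inverse (z + of_nat n))) + (Ln (z + of_nat m) - of_real (ln (real m))) - Ln z))
     \<longlonglongrightarrow> norm (Digamma z + 0 - Ln z)"
    by (rule tendsto_norm)
  then have "norm (Digamma z + 0 - Ln z) \<le> 2"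
  proof (rule LIMSEQ_le_const2, intro exI[of _ 0] allI impI)
    fix m :: nat
    have "(of_real (ln (real m)) - (\<Sum>n<m. inverse (z + of_nat n))) + (Ln (z + of_nat m) - of_real (ln (real m))) - Ln z
      = - ((\<Sum>n<m. 1 / (z + of_nat n)) - (Ln (z + of_nat m) - Ln z))"
      by (simp add: divide_inverse)
    then show "norm ((of_real (ln (real m)) - (\<Sum>n<m. inverse (z + of_nat n))) + (Ln (z + of_nat m) - of_real (ln (real m))) - Ln z) \<le> 2"
      using bd[of m] by (simp only: norm_minus_cancel)
  qed
  then show ?thesis by simp
qed

lemma norm_Ln_le:
  assumes "Re z \<ge> 1"
  shows "norm (Ln z) \<le> ln (norm z) + 2"
proof -
  have "z \<noteq> 0" using assms by auto
  have "norm z \<ge> 1" using complex_Re_le_cmod[of z] assms by linarith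
  have "\<bar>Im (Ln z)\<bar> < pi / 2" using assms Re_Ln_pos_lt[OF \<open>z \<noteq> 0\<close>] by auto
  then have "\<bar>Im (Ln z)\<bar> \<le> 2" using pi_less_4 by linarith
  moreover have "\<bar>Re (Ln z)\<bar> = ln (norm z)" using \<open>norm z \<ge> 1\<close> \<open>z \<noteq> 0\<close> by simp
  ultimately show ?thesis using cmod_le[of "Ln z"] by linarith
qed

text \<open>\<open>Digamma\<close> is the derivative of \<open>ln_Gamma\<close> and is bounded by ln
  R + 2 + 2 on the convex set Re x \<ge> 1, |x| \<le> R. The mean value inequality bounds the
  difference of \<open>ln_Gamma\<close>, whose real part is the logarithm of |Gamma|.\<close>

lemma Gamma_ratio_bound:
  assumes z: "Re z \<ge> 1" "norm z \<le> R" and w: "Re w \<ge> 1" "norm w \<le> R"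
  shows "norm (Gamma z) \<le> exp ((ln R + 4) * norm (z - w)) * norm (Gamma w)"
proof -
  let ?S = "{x. Re x \<ge> 1} \<inter> cball 0 R"
  have "norm (ln_Gamma z - ln_Gamma w) \<le> (ln R + 4) * norm (z - w)"
  proof (rule field_differentiable_bound[where S = ?S and f' = Digamma])
    show "convex ?S" by (intro convex_Int convex_halfspace_Re_ge convex_cball)
  next
    fix x assume x: "x \<in> ?S"
    then have "x \<notin> \<real>\<^sub>\<le>\<^sub>0" by (auto simp: complex_nonpos_Reals_iff)
    then show "(ln_Gamma has_field_derivative Digamma x) (at x within ?S)"
      by (rule has_field_derivative_at_within[OF has_field_derivative_ln_Gamma_complex])
    have "norm (Digamma x) \<le> norm (Digamma x - Ln x) + norm (Ln x)"
      using norm_triangle_ineq[of "Digamma x - Ln x" "Ln x"] by simp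
    also have "\<dots> \<le> 2 + (ln (norm x) + 2)"
      using x by (intro add_mono Digamma_minus_Ln_bound norm_Ln_le) auto
    also have "ln (norm x) \<le> ln R"
    proof -
      have "0 < norm x" using x complex_Re_le_cmod[of x] by auto
      then show ?thesis using x by (simp add: ln_mono)
    qed
    finally show "norm (Digamma x) \<le> ln R + 4" by simp
  qed (use z w in auto)
  moreover have "Re (ln_Gamma z - ln_Gamma w) \<le> norm (ln_Gamma z - ln_Gamma w)"
    by (rule complex_Re_le_cmod)
  ultimately have le: "Re (ln_Gamma z) \<le> (ln R + 4) * norm (z - w) + Re (ln_Gamma w)" by simp
  have "z \<notin> \<int>\<^sub>\<le>\<^sub>0" "w \<notin> \<int>\<^sub>\<le>\<^sub>0" using z w by (auto elim!: nonpos_Ints_cases)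
  then have "norm (Gamma z) = exp (Re (ln_Gamma z))" "norm (Gamma w) = exp (Re (ln_Gamma w))"
    by (simp_all add: Gamma_complex_altdef)
  with le show ?thesis by (simp add: exp_add[symmetric])
qed

text \<open>Each factor in the functional equation has modulus at least 1 because the imaginary part
  does. This moves arguments into Re z \<ge> 1, where \<open>Gamma_ratio_bound\<close>
  applies.\<close>

lemma norm_Gamma_le_shift:
  assumes "Im z \<ge> 1"
  shows "norm (Gamma z) \<le> norm (Gamma (z + of_nat k))"
proof (induction k)
  case (Suc k)
  have "z + of_nat k \<notin> \<int>\<^sub>\<le>\<^sub>0" using assms by (auto elim!: nonpos_Ints_cases simp: complex_eq_iff)
  then have "Gamma (z + of_nat k + 1) = (z + of_nat k) * Gamma (z + of_nat k)" by (rule Gamma_plus1)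
  moreover have "norm (z + of_nat k) \<ge> 1"
    using abs_Im_le_cmod[of "z + of_nat k"] assms by simp
  ultimately have "norm (Gamma (z + of_nat k)) \<le> norm (Gamma (z + of_nat (Suc k)))"
    by (simp add: norm_mult add_ac mult_le_cancel_right1)
  with Suc show ?case by linarith
qed simp

section \<open>Landau's local partial fraction bound\<close>

lemma remove_zero_holomorphic:
  assumes hol: "f holomorphic_on S" and S: "open S" "a \<in> S" and z: "f a = 0"
  obtains g where "g holomorphic_on S" "\<And>w. w \<in> S \<Longrightarrow> f w = (w - a) * g w"
proof
  show "(\<lambda>w. if w = a then deriv f a else (f w - f a) / (w - a)) holomorphic_on S"
    by (rule pole_lemma[OF hol]) (use S in \<open>simp add: interior_open\<close>)
qed (use z in auto)

text \<open>Dividing out zeros in the disc of radius \<open>R\<close> does not increase the bound on the disc of radius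
  \<open>3R\<close>, since there \<open>\<bar>w - \<rho>\<bar> \<ge> 2R\<close> on the boundary while \<open>\<bar>z - \<rho>\<bar> \<le> R\<close> at the centre.\<close>

lemma divided_zeros_bound:
  assumes hol: "G holomorphic_on ball z Q" and R: "R > 0" "3 * R < Q"
    and eq: "\<And>w. w \<in> ball z Q \<Longrightarrow> g w = (\<Prod>\<rho>\<leftarrow>ps. w - \<rho>) * G w"
    and ps: "set ps \<subseteq> cball z R"
    and bd: "\<And>w. w \<in> cball z (3 * R) \<Longrightarrow> norm (g w) \<le> B * norm (g z)"
    and B: "B \<ge> 0" and w: "w \<in> cball z (3 * R)"
  shows "2 ^ length ps * norm (G w) \<le> B * norm (G z)"
proof -
  have low: "(2 * R) ^ length ps \<le> norm (\<Prod>\<rho>\<leftarrow>ps. x - \<rho>)" if x: "dist z x = 3 * R" for x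
    using ps
  proof (induction ps)
    case (Cons a ps)
    have "dist z x \<le> dist z a + dist a x" by (rule dist_triangle)
    then have "2 * R \<le> norm (x - a)" using x Cons.prems by (simp add: dist_norm norm_minus_commute)
    then have "(2 * R) * (2 * R) ^ length ps \<le> norm (x - a) * norm (\<Prod>\<rho>\<leftarrow>ps. x - \<rho>)"
      using Cons R by (intro mult_mono) auto
    then show ?case by (simp add: norm_mult)
  qed simp
  have up: "norm (\<Prod>\<rho>\<leftarrow>ps. z - \<rho>) \<le> R ^ length ps"
    using ps
  proof (induction ps)
    case (Cons a ps)
    then have "norm (z - a) * norm (\<Prod>\<rho>\<leftarrow>ps. z - \<rho>) \<le> R * R ^ length ps"
      using R by (intro mult_mono) (auto simp: dist_norm)
    then show ?case by (simp add: norm_mult)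
  qed simp
  have zQ: "z \<in> ball z Q" using R by simp
  have main: "norm (G x) \<le> B * norm (G z) / 2 ^ length ps" if x: "dist z x = 3 * R" for x
  proof -
    have xQ: "x \<in> ball z Q" using x R by simp
    have "(2 * R) ^ length ps * norm (G x) \<le> norm (\<Prod>\<rho>\<leftarrow>ps. x - \<rho>) * norm (G x)"
      by (intro mult_right_mono low x) auto
    also have "\<dots> = norm (g x)" by (simp add: eq[OF xQ] norm_mult)
    also have "\<dots> \<le> B * norm (g z)" by (rule bd) (use x in simp)
    also have "\<dots> = B * (norm (\<Prod>\<rho>\<leftarrow>ps. z - \<rho>) * norm (G z))"
      by (simp add: eq[OF zQ] norm_mult)
    also have "\<dots> \<le> B * (R ^ length ps * norm (G z))"
      by (intro mult_left_mono mult_right_mono up B) auto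
    finally have "R ^ length ps * (2 ^ length ps * norm (G x)) \<le> R ^ length ps * (B * norm (G z))"
      by (simp only: power_mult_distrib mult_ac)
    then have "2 ^ length ps * norm (G x) \<le> B * norm (G z)"
      by (rule mult_left_le_imp_le) (use R in simp)
    then show ?thesis by (simp add: field_simps)
  qed
  have "norm (G w) \<le> B * norm (G z) / 2 ^ length ps"
  proof (rule maximum_modulus_frontier[where S = "cball z (3 * R)" and f = G])
    show "G holomorphic_on interior (cball z (3 * R))"
      by (rule holomorphic_on_subset[OF hol]) (use R in auto)
    show "continuous_on (closure (cball z (3 * R))) G"
      by (rule continuous_on_subset[OF holomorphic_on_imp_continuous_on[OF hol]]) (use R in auto)
    show "norm (G x) \<le> B * norm (G z) / 2 ^ length ps" if "x \<in> frontier (cball z (3 * R))" for x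
      by (rule main) (use that R in simp)
  qed (use w in auto)
  then show ?thesis by (simp add: field_simps)
qed

text \<open>Divide out zeros in the small disc, with multiplicity, as long as possible.
  \<open>divided_zeros_bound\<close> at the centre gives \<open>2 ^ length ps \<le> B\<close>, so a
  longest list exists, and its cofactor has no zero left in that disc.\<close>

lemma zero_factorization:
  assumes hol: "g holomorphic_on ball z Q" and R: "R > 0" "3 * R < Q"
    and nz: "g z \<noteq> 0"
    and bd: "\<And>w. w \<in> cball z (3 * R) \<Longrightarrow> norm (g w) \<le> B * norm (g z)"
  obtains ps G where "G holomorphic_on ball z Q"
    "\<And>w. w \<in> ball z Q \<Longrightarrow> g w = (\<Prod>\<rho>\<leftarrow>ps. w - \<rho>) * G w"
    "set ps \<subseteq> cball z R" "2 ^ length ps \<le> B"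
    "\<And>w. w \<in> cball z R \<Longrightarrow> G w \<noteq> 0"
    "\<And>w. w \<in> cball z (3 * R) \<Longrightarrow> norm (G w) \<le> B * norm (G z)"
proof -
  define P where "P ps \<longleftrightarrow> set ps \<subseteq> cball z R \<and> (\<exists>G. G holomorphic_on ball z Q \<and>
      (\<forall>w\<in>ball z Q. g w = (\<Prod>\<rho>\<leftarrow>ps. w - \<rho>) * G w))" for ps
  have zQ: "z \<in> ball z Q" using R by simp
  have "norm (g z) \<le> B * norm (g z)" by (rule bd) (use R in simp)
  then have B: "B \<ge> 1" using nz by simp
  have bounds: "2 ^ length ps * norm (G w) \<le> B * norm (G z)" "G z \<noteq> 0"
    if "set ps \<subseteq> cball z R" "G holomorphic_on ball z Q" "w \<in> cball z (3 * R)"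
      "\<forall>w\<in>ball z Q. g w = (\<Prod>\<rho>\<leftarrow>ps. w - \<rho>) * G w" for ps G w
  proof -
    show "2 ^ length ps * norm (G w) \<le> B * norm (G z)"
      by (rule divided_zeros_bound[where g = g, OF that(2) R _ that(1)]) (use that B bd in auto)
    show "G z \<noteq> 0" using that(4) zQ nz by force
  qed
  have len: "2 ^ length ps \<le> B" if Pps: "P ps" for ps
  proof -
    obtain G where G: "set ps \<subseteq> cball z R" "G holomorphic_on ball z Q"
      "\<forall>w\<in>ball z Q. g w = (\<Prod>\<rho>\<leftarrow>ps. w - \<rho>) * G w" using Pps unfolding P_def by blast
    have zc: "z \<in> cball z (3 * R)" using R by simp
    show ?thesis using bounds[OF G(1,2) zc G(3)] by simp
  qed
  have "length ps \<le> nat \<lceil>B\<rceil>" if "P ps" for ps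
  proof -
    have "real (length ps) < 2 ^ length ps" by (rule of_nat_less_two_power)
    then show ?thesis using len[OF that] by linarith
  qed
  then have fin: "\<forall>n. (\<exists>ps. P ps \<and> length ps = n) \<longrightarrow> n \<le> nat \<lceil>B\<rceil>" by blast
  have "P []" unfolding P_def using hol by auto
  then have "\<exists>n. \<exists>ps. P ps \<and> length ps = n" by blast
  then obtain n where n: "\<exists>ps. P ps \<and> length ps = n" "\<And>m. (\<exists>ps. P ps \<and> length ps = m) \<Longrightarrow> m \<le> n"
    using GreatestI_ex_nat[of "\<lambda>n. \<exists>ps. P ps \<and> length ps = n" "nat \<lceil>B\<rceil>"]
      Greatest_le_nat[of "\<lambda>n. \<exists>ps. P ps \<and> length ps = n" _ "nat \<lceil>B\<rceil>"] fin by blast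
  then obtain ps where ps: "P ps" and max: "\<And>qs. P qs \<Longrightarrow> length qs \<le> length ps" by blast
  obtain G where G: "set ps \<subseteq> cball z R" "G holomorphic_on ball z Q"
    "\<forall>w\<in>ball z Q. g w = (\<Prod>\<rho>\<leftarrow>ps. w - \<rho>) * G w" using ps unfolding P_def by blast
  show ?thesis
  proof
    show "G w \<noteq> 0" if w: "w \<in> cball z R" for w
    proof
      assume G0: "G w = 0"
      have "w \<in> ball z Q" using w R by auto
      then obtain H where H: "H holomorphic_on ball z Q" "\<And>x. x \<in> ball z Q \<Longrightarrow> G x = (x - w) * H x"
        using remove_zero_holomorphic[OF G(2) open_ball _ G0] by blast
      \<comment> \<open>A remaining zero of the cofactor would lengthen the maximal list.\<close>
      have "P (w # ps)" unfolding P_def using G w H by (auto simp: mult_ac)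
      from max[OF this] show False by simp
    qed
    show "norm (G w) \<le> B * norm (G z)" if w: "w \<in> cball z (3 * R)" for w
    proof -
      have "1 * norm (G w) \<le> 2 ^ length ps * norm (G w)"
        by (intro mult_right_mono) auto
      then show ?thesis using bounds(1)[OF G(1,2) w G(3)] by simp
    qed
  qed (use G len[OF ps] in auto)
qed

text \<open>A holomorphic branch h of log (G / G z) has real part at most M and vanishes at z. A
  Moebius map and the Schwarz lemma turn this one-sided bound into a bound for |h|, and Cauchy's
  inequality then bounds h' = G'/G.\<close>

lemma Borel_Caratheodory_deriv:
  assumes hol: "G holomorphic_on ball z Q" and r: "0 \<le> r" "r < R" "R < Q"
    and nz: "\<And>w. w \<in> cball z R \<Longrightarrow> G w \<noteq> 0"
    and bd: "\<And>w. w \<in> cball z R \<Longrightarrow> norm (G w) \<le> exp M * norm (G z)"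
    and w: "w \<in> cball z r" and M: "M > 0"
  shows "norm (deriv G w / G w) \<le> 16 * R / (R - r)\<^sup>2 * M"
proof -
  have R0: "R > 0" using r by simp
  have holR: "G holomorphic_on ball z R"
    by (rule holomorphic_on_subset[OF hol]) (use r in auto)
  obtain h0 where h0: "h0 holomorphic_on ball z R" "\<And>x. x \<in> ball z R \<Longrightarrow> G x = exp (h0 x)"
    using contractible_imp_holomorphic_log[OF holR convex_imp_contractible[OF convex_ball]] nz by (metis ball_subset_cball subsetD)
  define h where "h = (\<lambda>x. h0 x - h0 z)"
  have holh: "h holomorphic_on ball z R" unfolding h_def by (intro holomorphic_intros h0)
  have zR: "z \<in> ball z R" using R0 by simp
  have Gh: "G x = G z * exp (h x)" if "x \<in> ball z R" for x
    using h0(2)[OF that] h0(2)[OF zR] by (simp add: h_def exp_diff)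
  have Gz: "G z \<noteq> 0" using nz R0 by simp
  have Reh: "Re (h x) \<le> M" if "x \<in> ball z R" for x
  proof -
    have "norm (G z) * exp (Re (h x)) \<le> norm (G z) * exp M"
      using bd[of x] Gh[OF that] that by (simp add: norm_mult mult_ac)
    then show ?thesis using Gz by simp
  qed
  \<comment> \<open>The map v / (4M - v) sends Re v < 2M into the unit disc. As Re h \<le> M, the
    constant 4M keeps the needed inequality strict.\<close>
  define \<phi> where "\<phi> = (\<lambda>u. h (z + of_real R * u) / (4 * of_real M - h (z + of_real R * u)))"
  have in_ball: "z + of_real R * u \<in> ball z R" if "norm u < 1" for u
    using that R0 by (simp add: dist_norm norm_mult)
  have less: "norm (h x) < norm (4 * of_real M - h x)" if "x \<in> ball z R" for x
  proof (rule power2_less_imp_less)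
    have "(norm (4 * of_real M - h x))\<^sup>2 - (norm (h x))\<^sup>2 = 8 * M * (2 * M - Re (h x))"
      unfolding cmod_power2 by (simp add: power2_eq_square algebra_simps)
    moreover have "8 * M * (2 * M - Re (h x)) > 0" using M Reh[OF that] by simp
    ultimately show "(norm (h x))\<^sup>2 < (norm (4 * of_real M - h x))\<^sup>2" by linarith
  qed auto
  have den: "4 * of_real M - h x \<noteq> 0" if "x \<in> ball z R" for x
    using less[OF that] by auto
  have phi: "norm (\<phi> u) \<le> norm u" if u: "norm u < 1" for u
  proof (rule Schwarz_Lemma(1)[OF _ _ _ u])
    have "(\<lambda>u. h (z + of_real R * u)) holomorphic_on ball 0 1"
      by (rule holomorphic_on_compose_gen[OF _ holh, unfolded o_def])
        (use in_ball in \<open>auto intro!: holomorphic_intros\<close>)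
    then show "\<phi> holomorphic_on ball 0 1"
      unfolding \<phi>_def using den in_ball by (intro holomorphic_intros) auto
    show "\<phi> 0 = 0" by (simp add: \<phi>_def h_def)
    show "norm (\<phi> v) < 1" if "norm v < 1" for v
      using less[OF in_ball[OF that]] den[OF in_ball[OF that]] by (simp add: \<phi>_def norm_divide divide_simps)
  qed
  \<comment> \<open>The radius midway between r and R leaves room (R - r)/2 for Cauchy's inequality
    at any w in the inner disc.\<close>
  have hbd: "norm (h x) \<le> 8 * M * R / (R - r)" if x: "dist z x \<le> (r + R) / 2" for x
  proof -
    define u where "u = (x - z) / of_real R"
    have xu: "x = z + of_real R * u" using R0 by (simp add: u_def)
    have "norm u = dist z x / R" using R0 by (simp add: u_def norm_divide dist_norm norm_minus_commute)
    then have u: "norm u \<le> (r + R) / 2 / R" using divide_right_mono[OF x, of R] R0 by linarith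
    also have "\<dots> < 1" using r R0 by (simp add: field_simps)
    finally have u1: "norm u < 1" .
    have xb: "x \<in> ball z R" using in_ball[OF u1] xu by simp
    have "norm (h x) / norm (4 * of_real M - h x) \<le> norm u"
      using phi[OF u1] by (simp add: \<phi>_def xu[symmetric] norm_divide)
    then have "norm (h x) \<le> norm u * norm (4 * of_real M - h x)"
      using den[OF xb] by (simp add: divide_simps)
    also have "\<dots> \<le> norm u * (4 * M + norm (h x))"
      using norm_triangle_ineq4[of "4 * of_real M" "h x"] M by (intro mult_left_mono) (auto simp: norm_mult)
    also have "\<dots> \<le> (r + R) / 2 / R * (4 * M + norm (h x))"
      by (intro mult_right_mono u) (use M in auto)
    finally have "R * norm (h x) \<le> (r + R) / 2 * (4 * M + norm (h x))"
      using R0 by (simp add: field_simps)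
    then have "(R - r) * norm (h x) \<le> 4 * M * (r + R)" by (simp add: field_simps)
    also have "\<dots> \<le> 8 * M * R" using r M by simp
    finally show ?thesis using r by (simp add: field_simps)
  qed
  have wR: "w \<in> ball z R" using w r by simp
  have sub: "cball w ((R - r) / 2) \<subseteq> {x. dist z x \<le> (r + R) / 2}"
  proof
    fix x assume "x \<in> cball w ((R - r) / 2)"
    then show "x \<in> {x. dist z x \<le> (r + R) / 2}"
      using w dist_triangle[of z x w] by (simp add: field_simps)
  qed
  have sub': "{x. dist z x \<le> (r + R) / 2} \<subseteq> ball z R" using r by auto
  have "norm ((deriv ^^ 1) h w) \<le> fact 1 * (8 * M * R / (R - r)) / ((R - r) / 2) ^ 1"
  proof (rule Cauchy_inequality)
    show "h holomorphic_on ball w ((R - r) / 2)"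
      by (rule holomorphic_on_subset[OF holh]) (use sub sub' in force)
    show "continuous_on (cball w ((R - r) / 2)) h"
      by (rule continuous_on_subset[OF holomorphic_on_imp_continuous_on[OF holh]]) (use sub sub' in force)
    show "norm (h x) \<le> 8 * M * R / (R - r)" if "norm (w - x) = (R - r) / 2" for x
    proof (rule hbd)
      have "x \<in> cball w ((R - r) / 2)" using that by (simp add: dist_norm)
      then show "dist z x \<le> (r + R) / 2" using sub by blast
    qed
  qed (use r in auto)
  then have dh: "norm (deriv h w) \<le> 16 * R / (R - r)\<^sup>2 * M"
    using r by (simp add: power2_eq_square mult_ac)
  have "((\<lambda>x. G z * exp (h x)) has_field_derivative G z * (exp (h w) * deriv h w)) (at w)"
    by (rule derivative_eq_intros refl holomorphic_derivI[OF holh _ wR])+ auto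
  then have "(G has_field_derivative G z * (exp (h w) * deriv h w)) (at w)"
    by (rule has_field_derivative_transform_within_open[OF _ open_ball wR Gh[symmetric]])
  then have "deriv G w = G w * deriv h w" using Gh[OF wR] by (simp add: DERIV_imp_deriv)
  then have "deriv G w / G w = deriv h w" using Gh[OF wR] Gz by simp
  with dh show ?thesis by simp
qed

text \<open>Landau's lemma: split g into the product over its zeros and a zero-free cofactor.
  Logarithmic derivatives add, the product contributes the sum over \<open>ps\<close>, and the
  cofactor is controlled by \<open>Borel_Caratheodory_deriv\<close>.\<close>

lemma log_deriv_bound:
  assumes hol: "g holomorphic_on ball z Q" and r: "0 \<le> r" "r < R" "3 * R < Q"
    and nz: "g z \<noteq> 0" and M: "M > 0"
    and bd: "\<And>w. w \<in> cball z (3 * R) \<Longrightarrow> norm (g w) \<le> exp M * norm (g z)"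
  obtains ps where "real (length ps) * ln 2 \<le> M"
    "\<And>w. w \<in> cball z r \<Longrightarrow> w \<notin> set ps \<Longrightarrow> g w \<noteq> 0 \<and>
        norm (deriv g w / g w) \<le> (\<Sum>\<rho>\<leftarrow>ps. 1 / norm (w - \<rho>)) + 16 * R / (R - r)\<^sup>2 * M"
proof -
  have R: "R > 0" using r by simp
  show thesis
  proof (rule zero_factorization[where g = g and B = "exp M" and z = z and Q = Q and R = R])
    fix ps G
    assume G: "G holomorphic_on ball z Q"
      "\<And>w. w \<in> ball z Q \<Longrightarrow> g w = (\<Prod>\<rho>\<leftarrow>ps. w - \<rho>) * G w"
      and ps: "set ps \<subseteq> cball z R" "2 ^ length ps \<le> exp M"
      and Gnz: "\<And>w. w \<in> cball z R \<Longrightarrow> G w \<noteq> 0"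
      and Gbd: "\<And>w. w \<in> cball z (3 * R) \<Longrightarrow> norm (G w) \<le> exp M * norm (G z)"
    have "ln (2 ^ length ps) \<le> ln (exp M)" using ps(2) by (subst ln_le_cancel_iff) auto
    then have len: "real (length ps) * ln 2 \<le> M" by (simp add: ln_realpow)
    have main: "g w \<noteq> 0 \<and> norm (deriv g w / g w) \<le> (\<Sum>\<rho>\<leftarrow>ps. 1 / norm (w - \<rho>)) + 16 * R / (R - r)\<^sup>2 * M"
      if w: "w \<in> cball z r" "w \<notin> set ps" for w
    proof -
      let ?p = "\<lambda>w. \<Prod>\<rho>\<leftarrow>ps. w - \<rho>"
      have wQ: "w \<in> ball z Q" using w r R by auto
      have pnz: "?p w \<noteq> 0" using w(2) by (induction ps) auto
      \<comment> \<open>Regroups the product rule for one additional linear factor d = w -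
        a.\<close>
      have log_deriv_prod: "1 * P + P * S * d = (d * P) * (1 / d + S)" if "d \<noteq> 0" for P S d :: complex
        using that by (simp add: field_simps)
      have dp: "(?p has_field_derivative ?p w * (\<Sum>\<rho>\<leftarrow>ps. 1 / (w - \<rho>))) (at w)"
        using w(2)
      proof (induction ps)
        case (Cons a ps)
        then have IH: "((\<lambda>w. \<Prod>\<rho>\<leftarrow>ps. w - \<rho>) has_field_derivative
            (\<Prod>\<rho>\<leftarrow>ps. w - \<rho>) * (\<Sum>\<rho>\<leftarrow>ps. 1 / (w - \<rho>))) (at w)" and "w \<noteq> a" by auto
        have "((\<lambda>w. (w - a) * (\<Prod>\<rho>\<leftarrow>ps. w - \<rho>)) has_field_derivative
            1 * (\<Prod>\<rho>\<leftarrow>ps. w - \<rho>) + (\<Prod>\<rho>\<leftarrow>ps. w - \<rho>) * (\<Sum>\<rho>\<leftarrow>ps. 1 / (w - \<rho>)) * (w - a)) (at w)"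
          by (rule DERIV_mult[OF _ IH]) (auto intro!: derivative_eq_intros)
        also have "1 * (\<Prod>\<rho>\<leftarrow>ps. w - \<rho>) + (\<Prod>\<rho>\<leftarrow>ps. w - \<rho>) * (\<Sum>\<rho>\<leftarrow>ps. 1 / (w - \<rho>)) * (w - a)
            = (\<Prod>\<rho>\<leftarrow>a # ps. w - \<rho>) * (\<Sum>\<rho>\<leftarrow>a # ps. 1 / (w - \<rho>))"
          using log_deriv_prod[of "w - a"] \<open>w \<noteq> a\<close> by simp
        finally show ?case by simp
      qed simp
      have Gw: "G w \<noteq> 0" by (rule Gnz) (use w r in simp)
      have "((\<lambda>w. ?p w * G w) has_field_derivative ?p w * (\<Sum>\<rho>\<leftarrow>ps. 1 / (w - \<rho>)) * G w + deriv G w * ?p w) (at w)"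
        by (rule DERIV_mult[OF dp holomorphic_derivI[OF G(1) open_ball wQ]])
      then have "(g has_field_derivative ?p w * (\<Sum>\<rho>\<leftarrow>ps. 1 / (w - \<rho>)) * G w + deriv G w * ?p w) (at w)"
        by (rule has_field_derivative_transform_within_open[OF _ open_ball wQ G(2)[symmetric]])
      then have "deriv g w = ?p w * (\<Sum>\<rho>\<leftarrow>ps. 1 / (w - \<rho>)) * G w + deriv G w * ?p w"
        by (rule DERIV_imp_deriv)
      then have eq: "deriv g w / g w = (\<Sum>\<rho>\<leftarrow>ps. 1 / (w - \<rho>)) + deriv G w / G w"
        using G(2)[OF wQ] pnz Gw by (simp add: field_simps)
      have "norm (deriv G w / G w) \<le> 16 * R / (R - r)\<^sup>2 * M"
        by (rule Borel_Caratheodory_deriv[OF G(1) r(1,2) _ Gnz _ w(1) M]) (use r Gbd in auto)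
      moreover have "norm (\<Sum>\<rho>\<leftarrow>ps. 1 / (w - \<rho>)) \<le> (\<Sum>\<rho>\<leftarrow>ps. 1 / norm (w - \<rho>))"
      proof (induction ps)
        case (Cons a ps)
        then show ?case
          using norm_triangle_ineq[of "1 / (w - a)" "\<Sum>\<rho>\<leftarrow>ps. 1 / (w - \<rho>)"] by (simp add: norm_divide)
      qed simp
      ultimately show ?thesis
        using norm_triangle_ineq[of "\<Sum>\<rho>\<leftarrow>ps. 1 / (w - \<rho>)" "deriv G w / G w"] G(2)[OF wQ] pnz Gw
        unfolding eq by simp
    qed
    show thesis by (rule that[OF len main])
  qed (use hol R r nz bd in auto)
qed

section \<open>The logarithmic derivative of xi'\<close>

text \<open>The product formula is holomorphic above the real axis, so \<open>remove_sings\<close>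
  leaves its values unchanged there; the factor s - 1 is absorbed into
  \<open>zeta_num\<close>.\<close>

lemma xi_eq: "Im s > 0 \<Longrightarrow> xi s = 1/2 * s * of_real pi powr (- s / 2) * Gamma (s / 2) * zeta_num s"
  and xi_holomorphic_upper: "xi holomorphic_on {s. Im s > 0}"
proof -
  let ?H = "{s. Im s > 0}"
  let ?f = "\<lambda>s. 1/2 * s * (s - 1) * of_real pi powr (- s / 2) * Gamma (s / 2) * zeta s"
  let ?g = "\<lambda>s. 1/2 * s * of_real pi powr (- s / 2) * Gamma (s / 2) * zeta_num s"
  have nonpos: "s / 2 \<notin> \<int>\<^sub>\<le>\<^sub>0" if "Im s > 0" for s
    using that by (auto elim!: nonpos_Ints_cases simp: complex_eq_iff)
  have g: "?g holomorphic_on ?H"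
    using nonpos by (intro holomorphic_intros zeta_num_holomorphic) auto
  have fg: "?f s = ?g s" if "Im s > 0" for s
  proof -
    have "s \<noteq> 1" using that by auto
    then have "zeta_num s = (s - 1) * zeta s" by (simp add: zeta_eq)
    then show ?thesis by (simp add: mult_ac)
  qed
  have f: "?f holomorphic_on ?H"
    by (rule holomorphic_transform[OF g], rule fg[symmetric]) simp
  have "xi s = ?f s" if "Im s > 0" for s
    unfolding xi_def
    by (rule remove_sings_at_analytic) (use that f open_halfspace_Im_gt in \<open>auto simp: analytic_at\<close>)
  then have eq: "xi s = ?g s" if "Im s > 0" for s using fg that by metis
  then show "xi s = ?g s" if "Im s > 0" using that by blast
  show "xi holomorphic_on ?H"
    by (rule holomorphic_transform[OF g]) (use eq in auto)
qed

text \<open>Each of the four factors of xi at s is compared with the same factor at the centre,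
  losing at most a constant times a power of \<tau>.\<close>

lemma xi_growth:
  obtains C where "C > 0"
    "\<And>\<tau> s. \<tau> \<ge> 40 \<Longrightarrow> s \<in> cball (Complex 3 \<tau>) 16 \<Longrightarrow>
       norm (xi s) \<le> exp (C * ln \<tau>) * norm (xi (Complex 3 \<tau>))"
proof -
  \<comment> \<open>The disc reaches Re s = 3 - 16 = -13, inside the half-plane Re s > -14.\<close>
  obtain A B where A: "A \<ge> 0" "\<And>s. s \<in> {s. Re s > 1 - real 15} \<Longrightarrow> norm (zeta_num s) \<le> A * (1 + norm s) ^ B"
    using zeta_num_poly_bounded by (rule poly_bounded_onE) blast
  define K where "K = 2 * (pi powr 8 * (exp (16 * ln 2 + 64) * (2 * A * 3 ^ B)))"
  \<comment> \<open>The exponent 16 + B collects the powers of \<tau> from Gamma and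
    \<open>zeta_num\<close>; the summand |K| + 1 absorbs K, since ln \<tau> \<ge> 1.\<close>
  define C where "C = \<bar>K\<bar> + 16 + real B + 1"
  have K0: "K \<ge> 0" unfolding K_def using A by simp
  have bd: "norm (xi s) \<le> exp (C * ln \<tau>) * norm (xi (Complex 3 \<tau>))"
    if \<tau>: "\<tau> \<ge> 40" and s: "s \<in> cball (Complex 3 \<tau>) 16" for \<tau> s
  proof -
    let ?z = "Complex 3 \<tau>"
    have d: "norm (s - ?z) \<le> 16" using s by (simp add: dist_norm norm_minus_commute)
    have re: "Re s \<ge> -13" and im: "Im s \<ge> 24"
      using d \<tau> abs_Re_le_cmod[of "s - ?z"] abs_Im_le_cmod[of "s - ?z"] by auto
    have z_up: "norm ?z \<le> 3 + \<tau>" using cmod_le[of ?z] \<tau> by simp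
    have z_low: "\<tau> \<le> norm ?z" using abs_Im_le_cmod[of ?z] \<tau> by simp
    have s_up: "norm s \<le> 2 * \<tau>" using norm_triangle_ineq[of "s - ?z" ?z] d z_up \<tau> by simp
    have 1: "norm (1/2 * s) \<le> 2 * norm (1/2 * ?z)"
      using s_up z_low by (simp add: norm_mult)
    have 2: "norm (of_real pi powr (- s / 2) :: complex) \<le> pi powr 8 * norm (of_real pi powr (- ?z / 2) :: complex)"
    proof -
      have "pi powr (- Re s / 2) \<le> pi powr (8 + - 3 / 2)"
        using re pi_ge_two by (intro powr_mono) auto
      then show ?thesis unfolding powr_add by (simp add: norm_powr_real_powr)
    qed
    \<comment> \<open>Shifting by 8 brings the real part of s/2 from at least -13/2 to at least 3/2.
      The shifted point is within 8 + 8 = 16 of half the centre, and both lie in the disc of radius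
      2\<tau> about 0.\<close>
    have 3: "norm (Gamma (s / 2)) \<le> (exp (16 * ln 2 + 64) * \<tau> ^ 16) * norm (Gamma (?z / 2))"
    proof -
      have "norm (Gamma (s / 2)) \<le> norm (Gamma (s / 2 + of_nat 8))"
        by (rule norm_Gamma_le_shift) (use im in simp)
      also have "\<dots> \<le> exp ((ln (2 * \<tau>) + 4) * norm (s / 2 + of_nat 8 - ?z / 2)) * norm (Gamma (?z / 2))"
      proof (rule Gamma_ratio_bound)
        show "norm (s / 2 + of_nat 8) \<le> 2 * \<tau>"
          using norm_triangle_ineq[of "s / 2" "of_nat 8"] s_up \<tau> by (simp add: norm_divide)
        show "norm (?z / 2) \<le> 2 * \<tau>" using z_up \<tau> by (simp add: norm_divide)
      qed (use re in auto)
      also have "\<dots> \<le> exp ((ln (2 * \<tau>) + 4) * 16) * norm (Gamma (?z / 2))"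
      proof -
        have eq: "s / 2 + of_nat 8 - ?z / 2 = (s - ?z) / 2 + 8" by (simp add: diff_divide_distrib)
        have "norm (s / 2 + of_nat 8 - ?z / 2) \<le> 16"
          unfolding eq using norm_triangle_ineq[of "(s - ?z) / 2" 8] d by (simp add: norm_divide)
        moreover have "ln (2 * \<tau>) \<ge> 0" using \<tau> by simp
        ultimately have "(ln (2 * \<tau>) + 4) * norm (s / 2 + of_nat 8 - ?z / 2) \<le> (ln (2 * \<tau>) + 4) * 16"
          by (intro mult_left_mono) auto
        then show ?thesis by (rule mult_right_mono[OF exp_le_cancel_iff[THEN iffD2]]) simp
      qed
      also have "exp ((ln (2 * \<tau>) + 4) * 16) = exp (16 * ln 2 + 64) * \<tau> ^ 16"
      proof -
        have "(ln (2 * \<tau>) + 4) * 16 = (16 * ln 2 + 64) + real 16 * ln \<tau>"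
          using \<tau> by (simp add: ln_mult algebra_simps)
        then show ?thesis using \<tau> by (simp only: exp_add exp_of_nat_mult) simp
      qed
      finally show ?thesis .
    qed
    have 4: "norm (zeta_num s) \<le> (2 * A * 3 ^ B * \<tau> ^ B) * norm (zeta_num ?z)"
    proof -
      have "norm (zeta_num s) \<le> A * (1 + norm s) ^ B" by (rule A(2)) (use re in simp)
      also have "\<dots> \<le> A * (3 * \<tau>) ^ B"
        using s_up \<tau> by (intro mult_left_mono power_mono A) auto
      also have "\<dots> = 2 * A * 3 ^ B * \<tau> ^ B * (1 / 2)" by (simp add: power_mult_distrib)
      also have "\<dots> \<le> 2 * A * 3 ^ B * \<tau> ^ B * norm (zeta_num ?z)"
      proof (rule mult_left_mono)
        have "1 \<le> norm (?z - 1)" using abs_Im_le_cmod[of "?z - 1"] \<tau> by simp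
        moreover have "1 / 2 \<le> norm (dirichlet_zeta ?z)" by (rule norm_dirichlet_zeta_ge) simp
        ultimately have "1 * (1 / 2) \<le> norm (?z - 1) * norm (dirichlet_zeta ?z)"
          by (intro mult_mono) auto
        then show "1 / 2 \<le> norm (zeta_num ?z)" by (simp add: zeta_num_eq norm_mult)
      qed (use A \<tau> in auto)
      finally show ?thesis .
    qed
    have "norm (xi s) = norm (1/2 * s) * norm (of_real pi powr (- s / 2) :: complex) * norm (Gamma (s / 2)) * norm (zeta_num s)"
      using im by (simp only: xi_eq norm_mult)
    also have "\<dots> \<le> (2 * norm (1/2 * ?z)) * (pi powr 8 * norm (of_real pi powr (- ?z / 2) :: complex))
        * ((exp (16 * ln 2 + 64) * \<tau> ^ 16) * norm (Gamma (?z / 2))) * ((2 * A * 3 ^ B * \<tau> ^ B) * norm (zeta_num ?z))"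
      by (intro mult_mono 1 2 3 4) (use A \<tau> in auto)
    also have "\<dots> = (K * \<tau> ^ (16 + B)) * (norm (1/2 * ?z) * norm (of_real pi powr (- ?z / 2) :: complex) * norm (Gamma (?z / 2)) * norm (zeta_num ?z))"
      by (simp only: K_def power_add mult_ac)
    also have "norm (1/2 * ?z) * norm (of_real pi powr (- ?z / 2) :: complex) * norm (Gamma (?z / 2)) * norm (zeta_num ?z) = norm (xi ?z)"
      using \<tau> by (subst xi_eq) (simp_all only: norm_mult, simp)
    also have "K * \<tau> ^ (16 + B) * norm (xi ?z) \<le> exp (C * ln \<tau>) * norm (xi ?z)"
    proof (rule mult_right_mono)
      have "exp 1 \<le> \<tau>" using exp_le \<tau> by linarith
      then have "ln \<tau> \<ge> 1" using \<tau> by (subst ln_ge_iff) auto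
      have "K \<le> exp (\<bar>K\<bar> + 1)" using exp_ge_add_one_self[of "\<bar>K\<bar> + 1"] by linarith
      also have "\<dots> \<le> exp ((\<bar>K\<bar> + 1) * ln \<tau>)"
        using mult_left_mono[OF \<open>ln \<tau> \<ge> 1\<close>, of "\<bar>K\<bar> + 1"] by simp
      finally have "K * \<tau> ^ (16 + B) \<le> exp ((\<bar>K\<bar> + 1) * ln \<tau>) * \<tau> ^ (16 + B)"
        using \<tau> by (intro mult_right_mono) auto
      also have "exp ((\<bar>K\<bar> + 1) * ln \<tau>) * \<tau> ^ (16 + B) = exp (C * ln \<tau>)"
      proof -
        have "\<tau> ^ (16 + B) = exp (real (16 + B) * ln \<tau>)"
          using \<tau> by (simp only: exp_of_nat_mult) simp
        then show ?thesis by (simp add: C_def exp_add[symmetric] algebra_simps)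
      qed
      finally show "K * \<tau> ^ (16 + B) \<le> exp (C * ln \<tau>)" .
    qed auto
    finally show ?thesis .
  qed
  have "C > 0" unfolding C_def by linarith
  then show ?thesis using that bd by blast
qed

section \<open>The size of xi' at the centre\<close>

lemma norm_deriv_dirichlet_zeta_le:
  assumes "Re s \<ge> 3"
  shows "(dirichlet_zeta has_field_derivative deriv dirichlet_zeta s) (at s)"
    and "norm (deriv dirichlet_zeta s) \<le> 2"
proof -
  let ?H = "{s. Re s > 1}"
  have "(\<lambda>s. zeta_num s / (s - 1)) holomorphic_on ?H"
    by (intro holomorphic_intros zeta_num_holomorphic) auto
  then have hol: "dirichlet_zeta holomorphic_on ?H"
    by (rule holomorphic_transform) (auto simp: zeta_num_eq)
  then show "(dirichlet_zeta has_field_derivative deriv dirichlet_zeta s) (at s)"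
    by (rule holomorphic_derivI) (use assms in \<open>auto simp: open_halfspace_Re_gt\<close>)
  have far: "Re x \<ge> 2" if "x \<in> cball s 1" for x
    using that assms abs_Re_le_cmod[of "s - x"] by (simp add: dist_norm)
  then have sub: "cball s 1 \<subseteq> ?H" by force
  have "norm ((deriv ^^ 1) dirichlet_zeta s) \<le> fact 1 * 2 / 1 ^ 1"
  proof (rule Cauchy_inequality)
    show "dirichlet_zeta holomorphic_on ball s 1"
      by (rule holomorphic_on_subset[OF hol subset_trans[OF ball_subset_cball sub]])
    show "continuous_on (cball s 1) dirichlet_zeta"
      by (rule continuous_on_subset[OF holomorphic_on_imp_continuous_on[OF hol] sub])
    show "norm (dirichlet_zeta x) \<le> 2" if "norm (s - x) = 1" for x
      by (rule norm_dirichlet_zeta_le[OF far]) (use that in \<open>simp add: dist_norm\<close>)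
  qed simp
  then show "norm (deriv dirichlet_zeta s) \<le> 2" by simp
qed

text \<open>The logarithmic derivative of xi at the centre is half a digamma value plus bounded
  terms. Its modulus is at least 1 once \<tau> is large, which allows bounds normalised by xi to be
  renormalised by xi'.\<close>

lemma norm_deriv_xi_ge:
  assumes "\<tau> \<ge> 2 * exp 30"
  shows "norm (xi (Complex 3 \<tau>)) \<le> norm (deriv xi (Complex 3 \<tau>))" and "xi (Complex 3 \<tau>) \<noteq> 0"
proof -
  let ?z = "Complex 3 \<tau>" and ?D = "dirichlet_zeta" and ?D' = "deriv dirichlet_zeta"
  let ?S = "{s. Re s > 1} \<inter> {s. Im s > 0}"
  let ?X = "\<lambda>s. (1/2 * s) * (of_real pi powr (- s / 2) * (Gamma (s / 2) * ((s - 1) * ?D s)))"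
  have \<tau>1: "\<tau> \<ge> 2" using assms exp_ge_add_one_self[of 30] by linarith
  have eqX: "?X s = xi s" if "s \<in> ?S" for s
    using that by (subst xi_eq) (auto simp: zeta_num_eq)
  have zS: "?z \<in> ?S" using \<tau>1 by simp
  have np: "?z / 2 \<notin> \<int>\<^sub>\<le>\<^sub>0" using \<tau>1 by (auto elim!: nonpos_Ints_cases simp: complex_eq_iff)
  have D0: "norm (?D ?z) \<ge> 1 / 2" by (rule norm_dirichlet_zeta_ge) simp
  have nz: "?z \<noteq> 0" "?z - 1 \<noteq> 0" "Gamma (?z / 2) \<noteq> 0" "?D ?z \<noteq> 0" "of_real pi powr (- ?z / 2) \<noteq> (0::complex)"
  proof -
    show "?z \<noteq> 0" "?z - 1 \<noteq> 0" by (simp_all add: complex_eq_iff)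
    show "Gamma (?z / 2) \<noteq> 0" using np Gamma_eq_zero_iff by blast
    show "?D ?z \<noteq> 0" using D0 by auto
  qed simp
  then show xi0: "xi ?z \<noteq> 0" using eqX[OF zS] by auto
  \<comment> \<open>The logarithmic derivative of xi at the centre, one summand per factor.\<close>
  define E where "E = 1 / ?z - of_real (ln pi) / 2 + Digamma (?z / 2) / 2 + 1 / (?z - 1) + ?D' ?z / ?D ?z"
  have "(?X has_field_derivative ?X ?z * E) (at ?z)"
  proof -
    have 1: "((\<lambda>s. 1/2 * s) has_field_derivative 1/2) (at ?z)"
      by (auto intro!: derivative_eq_intros)
    have 2: "((\<lambda>s. of_real pi powr (- s / 2)) has_field_derivative of_real pi powr (- ?z / 2) * (- of_real (ln pi) / 2)) (at ?z)"
    proof -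
      have "((\<lambda>w. of_real pi powr w) has_field_derivative Ln (of_real pi) * of_real pi powr (- ?z / 2)) (at (- ?z / 2))"
        by (rule has_field_derivative_powr_right) simp
      then have "((\<lambda>s. of_real pi powr (- s / 2)) has_field_derivative Ln (of_real pi) * of_real pi powr (- ?z / 2) * (- 1 / 2)) (at ?z)"
        by (rule DERIV_chain2) (auto intro!: derivative_eq_intros)
      then show ?thesis by (simp add: Ln_of_real mult_ac)
    qed
    have 3: "((\<lambda>s. Gamma (s / 2)) has_field_derivative Gamma (?z / 2) * Digamma (?z / 2) * (1 / 2)) (at ?z)"
      by (rule DERIV_chain2[where f = Gamma, OF has_field_derivative_Gamma]) (use np in \<open>auto intro!: derivative_eq_intros\<close>)
    have 4: "((\<lambda>s. (s - 1) * ?D s) has_field_derivative 1 * ?D ?z + ?D' ?z * (?z - 1)) (at ?z)"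
      by (rule DERIV_mult[OF _ norm_deriv_dirichlet_zeta_le(1)]) (auto intro!: derivative_eq_intros)
    have alg: "1 / 2 * (p * (g * (d * D))) + (p * l * (g * (d * D)) + (g * \<psi> * (1 / 2) * (d * D) + (1 * D + D' * d) * g) * p) * (1 / 2 * x)
       = (1 / 2 * x) * (p * (g * (d * D))) * (1 / x + l + \<psi> / 2 + 1 / d + D' / D)"
      if "x \<noteq> 0" "d \<noteq> 0" "D \<noteq> 0" for p g d D l \<psi> D' x :: complex
      using that by (simp add: field_simps)
    show ?thesis
      using DERIV_mult[OF 1 DERIV_mult[OF 2 DERIV_mult[OF 3 4]]]
      unfolding alg[OF nz(1,2,4)] E_def by simp
  qed
  then have "(xi has_field_derivative ?X ?z * E) (at ?z)"
    by (rule has_field_derivative_transform_within_open[OF _ open_Int[OF open_halfspace_Re_gt open_halfspace_Im_gt] zS eqX])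
  then have deriv_eq: "deriv xi ?z = xi ?z * E" using eqX[OF zS] by (simp add: DERIV_imp_deriv)
  have "norm E \<ge> 1"
  proof -
    let ?e = "1 / ?z - of_real (ln pi) / 2 + 1 / (?z - 1) + ?D' ?z / ?D ?z"
    have a: "norm (1 / ?z) \<le> 1"
      using abs_Im_le_cmod[of ?z] \<tau>1 by (simp add: norm_divide divide_simps)
    have b: "norm (1 / (?z - 1)) \<le> 1"
      using abs_Im_le_cmod[of "?z - 1"] \<tau>1 by (simp add: norm_divide divide_simps)
    have c: "norm (of_real (ln pi) / 2 :: complex) \<le> 2"
      using ln_le_minus_one[of pi] pi_less_4 pi_ge_two ln_ge_zero[of pi] by (simp add: norm_divide)
    have d: "norm (?D' ?z / ?D ?z) \<le> 4"
    proof -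
      have "norm (?D' ?z) \<le> 4 * norm (?D ?z)" using norm_deriv_dirichlet_zeta_le(2)[of ?z] D0 by simp
      then show ?thesis using nz(4) by (simp add: norm_divide divide_simps)
    qed
    \<comment> \<open>8 = 1 + 2 + 1 + 4. The threshold on \<tau> makes |Ln (z/2)| at least 30, so
      the digamma term is at least (30 - 2)/2 = 14 and wins.\<close>
    have e: "norm ?e \<le> 8"
      using norm_triangle_ineq4[of "1 / ?z" "of_real (ln pi) / 2"]
        norm_triangle_ineq[of "1 / ?z - of_real (ln pi) / 2" "1 / (?z - 1)"]
        norm_triangle_ineq[of "1 / ?z - of_real (ln pi) / 2 + 1 / (?z - 1)" "?D' ?z / ?D ?z"] a b c d by linarith
    have "exp 30 \<le> norm (?z / 2)"
      using abs_Im_le_cmod[of "?z / 2"] assms by simp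
    then have "30 \<le> ln (norm (?z / 2))" using nz(1) by (subst ln_ge_iff) auto
    also have "\<dots> = Re (Ln (?z / 2))" using nz(1) by (subst Re_Ln) auto
    also have "\<dots> \<le> norm (Ln (?z / 2))" by (rule complex_Re_le_cmod)
    also have "\<dots> \<le> norm (Digamma (?z / 2)) + 2"
      using Digamma_minus_Ln_bound[of "?z / 2"] norm_triangle_ineq2[of "Ln (?z / 2)" "Digamma (?z / 2)"]
      by (simp add: norm_minus_commute)
    finally have psi: "norm (Digamma (?z / 2) / 2) \<ge> 14" by (simp add: norm_divide)
    have "E = Digamma (?z / 2) / 2 + ?e" by (simp add: E_def)
    then have "norm (Digamma (?z / 2) / 2) - norm ?e \<le> norm E"
      by (simp only: norm_diff_ineq)
    with psi e show ?thesis by linarith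
  qed
  then show "norm (xi ?z) \<le> norm (deriv xi ?z)"
    unfolding deriv_eq norm_mult by (simp add: mult_le_cancel_left1)
qed

section \<open>Choosing ordinates away from the zeros of xi'\<close>

text \<open>Take n + 1 points with spacing 1/(n + 1), where n is the length of the list. An entry
  can be closer than half the spacing to only one of them, so some point is far from all n
  entries.\<close>

lemma pigeonhole_gap:
  fixes ps :: "real list"
  obtains t where "\<tau> \<le> t" "t \<le> \<tau> + 1" "\<And>p. p \<in> set ps \<Longrightarrow> 1 / (2 * (real (length ps) + 1)) \<le> \<bar>t - p\<bar>"
proof (rule ccontr)
  let ?n = "length ps"
  let ?t = "\<lambda>k. \<tau> + real k / (real ?n + 1)"
  assume neg: "\<not> thesis"
  note found = that
  have "\<exists>p\<in>set ps. \<bar>?t k - p\<bar> < 1 / (2 * (real ?n + 1))" if "k \<in> {..?n}" for k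
  proof (rule ccontr)
    assume "\<not> ?thesis"
    then show False using neg found[of "?t k"] \<open>k \<in> {..?n}\<close> by (force simp: not_less)
  qed
  then obtain f where f: "\<And>k. k \<in> {..?n} \<Longrightarrow> f k \<in> set ps \<and> \<bar>?t k - f k\<bar> < 1 / (2 * (real ?n + 1))"
    by metis
  have "inj_on f {..?n}"
  proof (rule inj_onI)
    fix k l assume kl: "k \<in> {..?n}" "l \<in> {..?n}" "f k = f l"
    have "\<bar>?t k - ?t l\<bar> < 1 / (2 * (real ?n + 1)) + 1 / (2 * (real ?n + 1))"
      using f[OF kl(1)] f[OF kl(2)] kl(3) by linarith
    also have "\<dots> = 1 / (real ?n + 1)" by (simp add: field_simps)
    finally have "\<bar>real k - real l\<bar> / (real ?n + 1) < 1 / (real ?n + 1)"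
      by (simp add: diff_divide_distrib[symmetric] abs_divide)
    then have "\<bar>real k - real l\<bar> < 1" by (simp add: divide_less_cancel)
    then show "k = l" by linarith
  qed
  then have "card {..?n} \<le> card (set ps)"
    by (rule card_inj_on_le) (use f in auto)
  also have "\<dots> \<le> ?n" by (rule card_length)
  finally show False by simp
qed

text \<open>Cauchy's inequality on unit discs carries the growth bound from xi to xi', at the cost
  of one unit of radius; \<open>norm_deriv_xi_ge\<close> replaces xi by xi' at the centre.\<close>

lemma xi_deriv_disc:
  assumes C: "\<And>s. s \<in> cball (Complex 3 \<tau>) 16 \<Longrightarrow> norm (xi s) \<le> exp M * norm (xi (Complex 3 \<tau>))"
    and \<tau>: "\<tau> \<ge> 2 * exp 30"
  shows "deriv xi holomorphic_on ball (Complex 3 \<tau>) 16" "deriv xi (Complex 3 \<tau>) \<noteq> 0"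
    and "\<And>w. w \<in> cball (Complex 3 \<tau>) 15 \<Longrightarrow> norm (deriv xi w) \<le> exp M * norm (deriv xi (Complex 3 \<tau>))"
proof -
  let ?z = "Complex 3 \<tau>"
  have "\<tau> > 16" using \<tau> exp_ge_add_one_self[of 30] by linarith
  have sub: "cball ?z 16 \<subseteq> {s. Im s > 0}"
  proof
    fix s assume "s \<in> cball ?z 16"
    then show "s \<in> {s. Im s > 0}"
      using abs_Im_le_cmod[of "?z - s"] \<open>\<tau> > 16\<close> by (simp add: dist_norm)
  qed
  have hol: "xi holomorphic_on {s. Im s > 0}"
    by (rule xi_holomorphic_upper)
  show "deriv xi holomorphic_on ball ?z 16"
    by (rule holomorphic_on_subset[OF holomorphic_deriv[OF hol open_halfspace_Im_gt] subset_trans[OF ball_subset_cball sub]])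
  show "deriv xi ?z \<noteq> 0" using norm_deriv_xi_ge[OF \<tau>] by auto
  fix w assume w: "w \<in> cball ?z 15"
  have sub': "cball w 1 \<subseteq> cball ?z 16"
  proof
    fix x assume "x \<in> cball w 1"
    then show "x \<in> cball ?z 16" using w dist_triangle[of ?z x w] by simp
  qed
  have "norm ((deriv ^^ 1) xi w) \<le> fact 1 * (exp M * norm (xi ?z)) / 1 ^ 1"
  proof (rule Cauchy_inequality)
    show "xi holomorphic_on ball w 1"
      by (rule holomorphic_on_subset[OF hol subset_trans[OF ball_subset_cball subset_trans[OF sub' sub]]])
    show "continuous_on (cball w 1) xi"
      by (rule continuous_on_subset[OF holomorphic_on_imp_continuous_on[OF hol] subset_trans[OF sub' sub]])
    show "norm (xi x) \<le> exp M * norm (xi ?z)" if "norm (w - x) = 1" for x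
    proof (rule C)
      have "x \<in> cball w 1" using that by (simp add: dist_norm)
      then show "x \<in> cball ?z 16" using sub' by blast
    qed
  qed simp
  also have "\<dots> \<le> exp M * norm (deriv xi ?z)"
    using norm_deriv_xi_ge(1)[OF \<tau>] by (simp add: mult_left_mono)
  finally show "norm (deriv xi w) \<le> exp M * norm (deriv xi ?z)" by simp
qed

lemma xi_log_deriv_bound:
  obtains K where "\<And>\<tau>. \<tau> \<ge> 2 * exp 30 \<Longrightarrow> \<exists>T. \<tau> \<le> T \<and> T \<le> \<tau> + 1 \<and>
     (\<forall>\<sigma>\<in>{-1..2}. deriv xi (Complex \<sigma> T) \<noteq> 0 \<and>
        norm (deriv (deriv xi) (Complex \<sigma> T) / deriv xi (Complex \<sigma> T)) \<le> K * (ln T)\<^sup>2)"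
proof -
  obtain C where C: "C > 0" and growth: "\<And>\<tau> s. \<tau> \<ge> 40 \<Longrightarrow> s \<in> cball (Complex 3 \<tau>) 16 \<Longrightarrow>
       norm (xi s) \<le> exp (C * ln \<tau>) * norm (xi (Complex 3 \<tau>))"
    using xi_growth by blast
  \<comment> \<open>With M = C ln \<tau>, the sum over zeros is at most 2M * 2(2M + 1) = 8M^2 + 4M,
    and the cofactor adds 320M.\<close>
  define K where "K = 8 * C\<^sup>2 + 324 * C"
  have "\<exists>T. \<tau> \<le> T \<and> T \<le> \<tau> + 1 \<and>
     (\<forall>\<sigma>\<in>{-1..2}. deriv xi (Complex \<sigma> T) \<noteq> 0 \<and>
        norm (deriv (deriv xi) (Complex \<sigma> T) / deriv xi (Complex \<sigma> T)) \<le> K * (ln T)\<^sup>2)"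
    if \<tau>: "\<tau> \<ge> 2 * exp 30" for \<tau>
  proof -
    let ?z = "Complex 3 \<tau>" and ?M = "C * ln \<tau>"
    have \<tau>40: "\<tau> \<ge> 40" using \<tau> exp_ge_add_one_self[of 30] by linarith
    have "exp 1 \<le> \<tau>" using exp_le \<tau>40 by linarith
    then have L: "ln \<tau> \<ge> 1" using \<tau>40 by (subst ln_ge_iff) auto
    then have M: "?M > 0" using C by simp
    note disc = xi_deriv_disc[OF growth[OF \<tau>40] \<tau>]
    have hol: "deriv xi holomorphic_on ball ?z 16" using disc(1) by blast
    have bd: "norm (deriv xi w) \<le> exp ?M * norm (deriv xi ?z)" if "w \<in> cball ?z (3 * 5)" for w
      using disc(3) that by simp
    obtain ps where ps: "real (length ps) * ln 2 \<le> ?M"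
      and main: "\<And>w. w \<in> cball ?z (9/2) \<Longrightarrow> w \<notin> set ps \<Longrightarrow> deriv xi w \<noteq> 0 \<and>
        norm (deriv (deriv xi) w / deriv xi w) \<le> (\<Sum>\<rho>\<leftarrow>ps. 1 / norm (w - \<rho>)) + 16 * 5 / (5 - 9/2)\<^sup>2 * ?M"
      \<comment> \<open>The radii satisfy 3 * 5 = 15 < 16 and 9/2 < 5. The inner disc must contain
        the points \<sigma> + iT, whose distance from the centre is at most sqrt 17 < 9/2.\<close>
      by (rule log_deriv_bound[of "deriv xi" ?z 16 "9/2" 5 ?M]) (use hol disc(2) M bd in auto)
    obtain T where T: "\<tau> \<le> T" "T \<le> \<tau> + 1"
      and gap: "\<And>p. p \<in> set (map Im ps) \<Longrightarrow> 1 / (2 * (real (length (map Im ps)) + 1)) \<le> \<bar>T - p\<bar>"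
      using pigeonhole_gap[of \<tau> "map Im ps"] by metis
    let ?n = "real (length ps)"
    have "?n * (1 / 2) \<le> ?n * ln 2" using ln2_ge_two_thirds by (intro mult_left_mono) auto
    then have n: "?n \<le> 2 * ?M" using ps by linarith
    have "deriv xi (Complex \<sigma> T) \<noteq> 0 \<and>
        norm (deriv (deriv xi) (Complex \<sigma> T) / deriv xi (Complex \<sigma> T)) \<le> K * (ln T)\<^sup>2"
      if \<sigma>: "\<sigma> \<in> {-1..2}" for \<sigma>
    proof -
      let ?w = "Complex \<sigma> T"
      have far: "1 / (2 * (?n + 1)) \<le> norm (?w - \<rho>)" if "\<rho> \<in> set ps" for \<rho>
        using gap[of "Im \<rho>"] that abs_Im_le_cmod[of "?w - \<rho>"] by simp
      have notin: "?w \<notin> set ps"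
      proof
        assume "?w \<in> set ps"
        from far[OF this] have "1 / (2 * (?n + 1)) \<le> 0" by simp
        moreover have "1 / (2 * (?n + 1)) > 0" by simp
        ultimately show False by linarith
      qed
      have "dist ?z ?w \<le> 9 / 2"
      proof -
        have "dist ?z ?w = sqrt ((3 - \<sigma>)\<^sup>2 + (\<tau> - T)\<^sup>2)"
          by (simp add: dist_norm cmod_def)
        also have "\<dots> \<le> sqrt (4\<^sup>2 + 1\<^sup>2)"
        proof -
          have "(3 - \<sigma>)\<^sup>2 \<le> 4\<^sup>2" using \<sigma> by (intro power_mono) auto
          moreover have "(\<tau> - T)\<^sup>2 \<le> 1\<^sup>2" using T by (intro power2_le_iff_abs_le[THEN iffD2]) auto
          ultimately show ?thesis by (intro real_sqrt_le_mono add_mono)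
        qed
        also have "\<dots> \<le> 9 / 2" by (rule real_le_lsqrt) (auto simp: power2_eq_square)
        finally show ?thesis .
      qed
      then have w: "?w \<in> cball ?z (9/2)" by simp
      \<comment> \<open>Each zero is at distance at least 1/(2(n + 1)), already by its ordinate, so
        the n terms give O(n^2) with n at most 2M.\<close>
      have "(\<Sum>\<rho>\<leftarrow>ps. 1 / norm (?w - \<rho>)) \<le> (\<Sum>\<rho>\<leftarrow>ps. 2 * (?n + 1))"
      proof (rule sum_list_mono)
        fix \<rho> assume "\<rho> \<in> set ps"
        have "1 / norm (?w - \<rho>) \<le> 1 / (1 / (2 * (?n + 1)))"
          by (rule divide_left_mono[OF far[OF \<open>\<rho> \<in> set ps\<close>]])
            (use notin \<open>\<rho> \<in> set ps\<close> in \<open>auto intro!: mult_pos_pos divide_pos_pos\<close>)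
        then show "1 / norm (?w - \<rho>) \<le> 2 * (?n + 1)" by simp
      qed
      also have "\<dots> = ?n * (2 * (?n + 1))" by (simp add: sum_list_triv)
      also have "\<dots> \<le> (2 * ?M) * (2 * (2 * ?M + 1))" by (intro mult_mono) (use n M in auto)
      finally have "norm (deriv (deriv xi) ?w / deriv xi ?w) \<le> (2 * ?M) * (2 * (2 * ?M + 1)) + 320 * ?M"
        using main[OF w notin] by (simp add: power2_eq_square)
      also have "\<dots> = 8 * C\<^sup>2 * (ln \<tau>)\<^sup>2 + 324 * C * ln \<tau>"
        by (simp add: power2_eq_square algebra_simps)
      also have "\<dots> \<le> 8 * C\<^sup>2 * (ln \<tau>)\<^sup>2 + 324 * C * (ln \<tau>)\<^sup>2"
        using L C self_le_power[OF L, of 2] by simp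
      also have "\<dots> = K * (ln \<tau>)\<^sup>2" by (simp add: K_def algebra_simps)
      also have "\<dots> \<le> K * (ln T)\<^sup>2"
        using L C T \<tau>40 by (intro mult_left_mono power_mono ln_mono) (auto simp: K_def)
      finally show ?thesis using main[OF w notin] by blast
    qed
    then show ?thesis using T by blast
  qed
  then show ?thesis using that by blast
qed

theorem theorem4:
  fixes C :: real
  assumes "Riemann_Hypothesis" and "C > 2"
  shows "\<exists>T :: nat \<Rightarrow> real.
           filterlim T at_top sequentially \<and>
           (\<exists>B. \<forall>j. \<bar>T (Suc j) - T j\<bar> \<le> B) \<and>
           (\<forall>j. T j > 1) \<and>
           (\<exists>K. \<forall>j. \<forall>\<sigma>\<in>{-1..2}.
              deriv xi (Complex \<sigma> (T j)) \<noteq> 0 \<and>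
              norm ((deriv ^^ 2) xi (Complex \<sigma> (T j)) / deriv xi (Complex \<sigma> (T j)))
                \<le> K * ln (T j) powr (C + 1))"
proof -
  define \<tau>\<^sub>0 :: real where "\<tau>\<^sub>0 = 2 * exp 30"
  have \<tau>\<^sub>0: "\<tau>\<^sub>0 \<ge> 40" using exp_ge_add_one_self[of 30] unfolding \<tau>\<^sub>0_def by linarith
  obtain K where K: "\<And>\<tau>. \<tau> \<ge> \<tau>\<^sub>0 \<Longrightarrow> \<exists>T. \<tau> \<le> T \<and> T \<le> \<tau> + 1 \<and>
     (\<forall>\<sigma>\<in>{-1..2}. deriv xi (Complex \<sigma> T) \<noteq> 0 \<and>
        norm (deriv (deriv xi) (Complex \<sigma> T) / deriv xi (Complex \<sigma> T)) \<le> K * (ln T)\<^sup>2)"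
    using xi_log_deriv_bound unfolding \<tau>\<^sub>0_def by blast
  \<comment> \<open>One ordinate is taken from each consecutive unit interval, which yields
    divergence to infinity and gaps of at most 2.\<close>
  have "\<exists>T. \<tau>\<^sub>0 + real j \<le> T \<and> T \<le> \<tau>\<^sub>0 + real j + 1 \<and>
     (\<forall>\<sigma>\<in>{-1..2}. deriv xi (Complex \<sigma> T) \<noteq> 0 \<and>
        norm (deriv (deriv xi) (Complex \<sigma> T) / deriv xi (Complex \<sigma> T)) \<le> K * (ln T)\<^sup>2)" for j
    by (rule K) simp
  then obtain T where T: "\<And>j. \<tau>\<^sub>0 + real j \<le> T j" "\<And>j. T j \<le> \<tau>\<^sub>0 + real j + 1"
    and bd: "\<And>j \<sigma>. \<sigma> \<in> {-1..2} \<Longrightarrow> deriv xi (Complex \<sigma> (T j)) \<noteq> 0 \<and>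
        norm (deriv (deriv xi) (Complex \<sigma> (T j)) / deriv xi (Complex \<sigma> (T j))) \<le> K * (ln (T j))\<^sup>2"
    by metis
  have "real j \<le> T j" for j using T(1)[of j] \<tau>\<^sub>0 by linarith
  then have "filterlim T at_top sequentially"
    by (intro filterlim_at_top_mono[OF filterlim_real_sequentially] always_eventually allI)
  moreover have "\<bar>T (Suc j) - T j\<bar> \<le> 2" for j
    using T(1)[of j] T(2)[of j] T(1)[of "Suc j"] T(2)[of "Suc j"] by simp
  moreover have "T j > 1" for j using T(1)[of j] \<tau>\<^sub>0 by linarith
  moreover have "norm ((deriv ^^ 2) xi (Complex \<sigma> (T j)) / deriv xi (Complex \<sigma> (T j)))
      \<le> \<bar>K\<bar> * ln (T j) powr (C + 1)" if "\<sigma> \<in> {-1..2}" for \<sigma> j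
  proof -
    have "T j \<ge> 40" using T(1)[of j] \<tau>\<^sub>0 by linarith
    moreover from this have "exp 1 \<le> T j" using exp_le by linarith
    ultimately have L: "ln (T j) \<ge> 1" by (subst ln_ge_iff) auto
    have "norm (deriv (deriv xi) (Complex \<sigma> (T j)) / deriv xi (Complex \<sigma> (T j))) \<le> K * (ln (T j))\<^sup>2"
      using bd[OF that] by blast
    also have "\<dots> \<le> \<bar>K\<bar> * (ln (T j))\<^sup>2" by (intro mult_right_mono) auto
    also have "(ln (T j))\<^sup>2 = ln (T j) powr 2" using L by simp
    \<comment> \<open>Raising the exponent from 2 to C + 1 is harmless because ln (T j) \<ge>
      1.\<close>
    also have "\<bar>K\<bar> * \<dots> \<le> \<bar>K\<bar> * ln (T j) powr (C + 1)"
      using L assms(2) by (intro mult_left_mono powr_mono) auto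
    finally show ?thesis by (simp add: numeral_2_eq_2)
  qed
  ultimately show ?thesis using bd by blast
qed

end
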